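(* For any integers $n\ge 3$, $0\le k\le n-2$ and $1\le \ell\le \left\lfloor\frac{n-k+1}{3}\right\rfloor$ such that $\frac{k(k+1)}{2}+\ell\ge 2$, there exists a metric $g$ of lorentzian signature on $\mathbb{R}^n$ such that $g$ admits a metric $\bar g$ that is geodesically equivalent but not affinely equivalent to $g$, and such that $D(g)=\frac{k(k+1)}{2}+\ell$.
   Context: All objects are $C^\infty$-smooth. Lorentzian signature means signature $(1,n-1)$. Two pseudo-Riemannian metrics $g,\bar g$ on a manifold are geodesically equivalent if every geodesic of $g$ is, after reparametrization, a geodesic of $\bar g$; they are affinely equivalent if their Levi-Civita connections coincide. The degree of mobility $D(g)$ is the dimension of the linear space of symmetric $(0,2)$-tensor fields $a_{ij}$ for which there is a $1$-form $\lambda_i$ with $a_{ij,k}=\lambda_i g_{jk}+\lambda_j g_{ik}$, where the comma denotes covariant differentiation with respect to the Levi-Civita connection of $g$. *)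

theory Defs
  imports "HOL-Analysis.Analysis" "HOL-Library.Function_Algebras"
begin

definition pd :: "'n::finite \<Rightarrow> (real ^ 'n \<Rightarrow> real) \<Rightarrow> real ^ 'n \<Rightarrow> real"
  where "pd i f x = frechet_derivative f (at x) (axis i 1)"

primrec Ck :: "nat \<Rightarrow> (real ^ 'n::finite \<Rightarrow> real) \<Rightarrow> bool" where
  "Ck 0 f \<longleftrightarrow> continuous_on UNIV f"
| "Ck (Suc m) f \<longleftrightarrow> (\<forall>x. f differentiable (at x)) \<and> (\<forall>i. Ck m (pd i f))"

definition smooth :: "(real ^ 'n::finite \<Rightarrow> real) \<Rightarrow> bool"
  where "smooth f \<longleftrightarrow> (\<forall>m. Ck m f)"

text \<open>A \<open>(0,2)\<close>-tensor field on $\mathbb{R}^n$ is given by its matrix of components in the standard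
  coordinates, a 1-form by its vector of components.\<close>

type_synonym 'n tensor2 = "real ^ 'n \<Rightarrow> real ^ 'n ^ 'n"

definition smooth_form :: "(real ^ 'n::finite \<Rightarrow> real ^ 'n) \<Rightarrow> bool"
  where "smooth_form w \<longleftrightarrow> (\<forall>i. smooth (\<lambda>x. w x $ i))"

definition smooth_tensor2 :: "'n::finite tensor2 \<Rightarrow> bool"
  where "smooth_tensor2 a \<longleftrightarrow> (\<forall>i j. smooth (\<lambda>x. a x $ i $ j))"

definition sym_tensor2 :: "'n::finite tensor2 \<Rightarrow> bool"
  where "sym_tensor2 a \<longleftrightarrow> (\<forall>x. transpose (a x) = a x)"

definition pseudo_riemannian :: "'n::finite tensor2 \<Rightarrow> bool"
  where "pseudo_riemannian g \<longleftrightarrow>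
    smooth_tensor2 g \<and> sym_tensor2 g \<and> (\<forall>x. invertible (g x))"

text \<open>\<open>has_signature A p q\<close>: in a suitable basis (the columns of \<open>P\<close>) the bilinear form \<open>A\<close> is
  diagonal with \<open>p\<close> entries \<open>-1\<close> and \<open>q\<close> entries \<open>+1\<close>. So the first number of the signature counts
  the negative directions, and signature \<open>(1,n-1)\<close> is \<open>(-,+,\<dots>,+)\<close>.\<close>

definition has_signature :: "real ^ 'n::finite ^ 'n \<Rightarrow> nat \<Rightarrow> nat \<Rightarrow> bool"
  where "has_signature A p q \<longleftrightarrow>
    (\<exists>(P :: real ^ 'n ^ 'n) N. invertible P \<and> card N = p \<and> card (- N) = q \<and>
       transpose P ** A ** P = (\<chi> i j. if i = j then (if i \<in> N then - 1 else 1) else 0))"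

definition lorentzian :: "'n::finite tensor2 \<Rightarrow> bool"
  where "lorentzian g \<longleftrightarrow>
    pseudo_riemannian g \<and> (\<forall>x. has_signature (g x) 1 (CARD('n) - 1))"

text \<open>\<open>christoffel g x i j k\<close> is the Christoffel symbol of the second kind, with upper index \<open>i\<close> and
  lower indices \<open>j\<close>, \<open>k\<close>, at the point \<open>x\<close>.\<close>

definition christoffel :: "'n::finite tensor2 \<Rightarrow> real ^ 'n \<Rightarrow> 'n \<Rightarrow> 'n \<Rightarrow> 'n \<Rightarrow> real"
  where "christoffel g x i j k =
    (\<Sum>m\<in>UNIV. matrix_inv (g x) $ i $ m *
       (pd j (\<lambda>y. g y $ m $ k) x + pd k (\<lambda>y. g y $ m $ j) x - pd m (\<lambda>y. g y $ j $ k) x)) / 2"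

text \<open>\<open>cov_deriv g a x i j k\<close> is $a_{ij,k}$ at \<open>x\<close>.\<close>

definition cov_deriv :: "'n::finite tensor2 \<Rightarrow> 'n tensor2 \<Rightarrow> real ^ 'n \<Rightarrow> 'n \<Rightarrow> 'n \<Rightarrow> 'n \<Rightarrow> real"
  where "cov_deriv g a x i j k =
    pd k (\<lambda>y. a y $ i $ j) x
    - (\<Sum>m\<in>UNIV. christoffel g x m k i * a x $ m $ j)
    - (\<Sum>m\<in>UNIV. christoffel g x m k j * a x $ i $ m)"

text \<open>A connection on $\mathbb{R}^n$ is determined by its Christoffel symbols in the global standard
  coordinates, so the Levi-Civita connections coincide iff the symbols do.\<close>

definition affinely_equivalent :: "'n::finite tensor2 \<Rightarrow> 'n tensor2 \<Rightarrow> bool"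
  where "affinely_equivalent g h \<longleftrightarrow> christoffel g = christoffel h"

definition open_interval :: "real set \<Rightarrow> bool"
  where "open_interval I \<longleftrightarrow> open I \<and> is_interval I \<and> I \<noteq> {}"

text \<open>Geodesics are affinely parametrized curves on an open interval \<open>I\<close>; the values of \<open>c\<close> outside
  \<open>I\<close> are irrelevant. A solution of the geodesic equation of a smooth metric is automatically
  smooth on \<open>I\<close>.\<close>

definition geodesic :: "'n::finite tensor2 \<Rightarrow> real set \<Rightarrow> (real \<Rightarrow> real ^ 'n) \<Rightarrow> bool"
  where "geodesic g I c \<longleftrightarrow> open_interval I \<and>
    (\<exists>v. \<forall>t\<in>I. (c has_vector_derivative v t) (at t) \<and>
       (v has_vector_derivative
         (\<chi> i. - (\<Sum>j\<in>UNIV. \<Sum>k\<in>UNIV. christoffel g (c t) i j k * v t $ j * v t $ k))) (at t))"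

definition reparametrization :: "real set \<Rightarrow> real set \<Rightarrow> (real \<Rightarrow> real) \<Rightarrow> bool"
  where "reparametrization J I \<phi> \<longleftrightarrow>
    open_interval J \<and> open_interval I \<and> bij_betw \<phi> J I \<and>
    (\<forall>m. \<forall>t\<in>J. (deriv ^^ m) \<phi> differentiable (at t)) \<and> (\<forall>t\<in>J. deriv \<phi> t \<noteq> 0)"

definition geodesically_equivalent :: "'n::finite tensor2 \<Rightarrow> 'n tensor2 \<Rightarrow> bool"
  where "geodesically_equivalent g h \<longleftrightarrow>
    (\<forall>I c. geodesic g I c \<longrightarrow> (\<exists>J \<phi>. reparametrization J I \<phi> \<and> geodesic h J (c \<circ> \<phi>)))"

definition mobility_space :: "'n::finite tensor2 \<Rightarrow> 'n tensor2 set"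
  where "mobility_space g =
    {a. smooth_tensor2 a \<and> sym_tensor2 a \<and>
        (\<exists>w. smooth_form w \<and>
          (\<forall>x i j k. cov_deriv g a x i j k = w x $ i * g x $ j $ k + w x $ j * g x $ i $ k))}"

definition scale_tensor2 :: "real \<Rightarrow> 'n::finite tensor2 \<Rightarrow> 'n tensor2"
  where "scale_tensor2 r a = (\<lambda>x. r *\<^sub>R a x)"

global_interpretation tensor2: vector_space "scale_tensor2 :: real \<Rightarrow> 'n::finite tensor2 \<Rightarrow> 'n tensor2"
  by unfold_locales (auto simp: scale_tensor2_def fun_eq_iff scaleR_add_left scaleR_add_right)

text \<open>The library dimension of an infinite-dimensional space is \<open>0\<close>, so a positive value of
  \<open>degree_of_mobility\<close> includes finite-dimensionality.\<close>

definition degree_of_mobility :: "'n::finite tensor2 \<Rightarrow> nat"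
  where "degree_of_mobility g = tensor2.dim (mobility_space g)"

end

(* If V is parallel and X is homothetic (nabla X = Id) for g, with dual 1-forms v and xi, then the
   symmetric products vv', v xi and xi xi all solve the mobility equation. So take for g a product
   of k - 1 lines and l indecomposable cones: its parallel 1-forms together with xi give
   k(k+1)/2 solutions, and the restrictions of g to the l cones give l more. This covers k >= 1,
   and k = 0 reduces to it because the pairs (0, l) and (1, l - 1) give the same number.

   Writing a cone dr^2 + r^2 ds^2 over a flat base with r = exp t makes it the conformally flat
   metric e^{2t}(dt^2 + ds^2), which lives on a whole vector space and has constant Christoffel
   symbols; a line is treated as a cone over a point, i.e. as the half-line r > 0. That there are no
   other solutions follows from commuting second derivatives of the frame components: all of them
   are determined by their values at the origin.

   The solution g + xi xi corresponds to h = s g - s^2 xi xi with s = 1/(1 + g(X,X)). Along a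
   g-geodesic c(t) the function q(t) = 1 + g(X,X) is a quadratic polynomial, and a parameter change
   with phi' = q(phi) turns c into an h-geodesic. *)

theory Submission
  imports Defs "HOL-Computational_Algebra.Polynomial"
begin

subsection \<open>Partial derivatives and smooth functions\<close>

text \<open>A cone over a one-dimensional base is a flat plane and carries two more parallel forms.
  So every base gets dimension at least two and every cone costs three coordinates; for k \<ge> 1
  the bound on l says just that k - 1 lines and l such cones fit: (k - 1) + 3 l \<le> n. Surplus
  coordinates enlarge one base and change no count. The minus sign sits in a base and not on a
  radius: then g(X,X) is a sum of squares of radii, 1 + g(X,X) never vanishes, and h is a metric on
  the whole space. The radial field of a single cone is not homothetic for the product; only the sum
  of all radial fields is. Hence the cones share one form xi and are told apart only by the
  restrictions of g. The obstacle to the upper bound is that the mobility equation says nothing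
  about the derivatives of lambda. Mixed partials recover enough of them once each base offers a
  second direction to play against the first. The outcome is that lambda vanishes along the bases
  and that a solution restricts to each base as a constant multiple of g.\<close>

lemma pd_eqI: "(f has_derivative f') (at x) \<Longrightarrow> pd i f x = f' (axis i 1)"
  unfolding pd_def by (metis frechet_derivative_at)

lemma has_derivative_frechet:
  "f differentiable (at x) \<Longrightarrow> (f has_derivative frechet_derivative f (at x)) (at x)"
  using frechet_derivative_works by blast

lemma pd_const [simp]: "pd i (\<lambda>x. c) x = 0"
  using pd_eqI[OF has_derivative_const] by blast

lemma pd_add:
  "f differentiable (at x) \<Longrightarrow> h differentiable (at x) \<Longrightarrow>
    pd i (\<lambda>x. f x + h x) x = pd i f x + pd i h x"
  using pd_eqI[OF has_derivative_add[OF has_derivative_frechet has_derivative_frechet]]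
  by (simp add: pd_def)

lemma pd_diff:
  "f differentiable (at x) \<Longrightarrow> h differentiable (at x) \<Longrightarrow>
    pd i (\<lambda>x. f x - h x) x = pd i f x - pd i h x"
  using pd_eqI[OF has_derivative_diff[OF has_derivative_frechet has_derivative_frechet]]
  by (simp add: pd_def)

lemma pd_mult:
  "f differentiable (at x) \<Longrightarrow> h differentiable (at x) \<Longrightarrow>
    pd i (\<lambda>x. f x * h x) x = pd i f x * h x + f x * pd i h x"
  using pd_eqI[OF has_derivative_mult[OF has_derivative_frechet has_derivative_frechet], of f x h i]
  by (simp add: pd_def)

lemma pd_cmult:
  "f differentiable (at x) \<Longrightarrow> pd k (\<lambda>x. c * f x) x = c * pd k f x"
  by (simp add: pd_mult)

lemma pd_sum:
  assumes "\<And>m. m \<in> A \<Longrightarrow> f m differentiable (at x)"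
  shows "pd i (\<lambda>x. \<Sum>m\<in>A. f m x) x = (\<Sum>m\<in>A. pd i (f m) x)"
  using pd_eqI[OF has_derivative_sum[OF has_derivative_frechet[OF assms]]]
  by (simp add: pd_def)

lemma pd_inverse:
  fixes f :: "real ^ 'n::finite \<Rightarrow> real"
  assumes "f differentiable (at x)" "f x \<noteq> 0"
  shows "pd i (\<lambda>x. inverse (f x)) x = - (pd i f x * (inverse (f x) * inverse (f x)))"
  using pd_eqI[OF Deriv.has_derivative_inverse[OF assms(2) has_derivative_frechet[OF assms(1)]]]
  by (simp add: pd_def)

lemma has_derivative_exp_coord:
  fixes x :: "real ^ 'n::finite"
  shows "((\<lambda>x. exp (c * x $ j)) has_derivative (\<lambda>h. exp (c * x $ j) * (c * h $ j))) (at x)"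
proof -
  have "((\<lambda>x. c * x $ j) has_derivative (\<lambda>h. c * h $ j)) (at x)"
    by (intro has_derivative_mult_right bounded_linear_imp_has_derivative bounded_linear_vec_nth)
  from has_derivative_compose[OF this DERIV_exp[THEN has_field_derivative_imp_has_derivative]]
  show ?thesis by simp
qed

lemma pd_exp_coord:
  fixes x :: "real ^ 'n::finite"
  shows "pd i (\<lambda>x. exp (c * x $ j)) x = (if i = j then c * exp (c * x $ j) else 0)"
  by (simp add: pd_eqI[OF has_derivative_exp_coord] axis_def)

lemma Ck_differentiable: "Ck (Suc m) f \<Longrightarrow> f differentiable (at x)"
  by simp

lemma Ck_SucD: "Ck (Suc m) f \<Longrightarrow> Ck m f"
proof (induction m arbitrary: f)
  case 0
  then show ?case
    by (auto intro!: differentiable_imp_continuous_on simp: differentiable_on_def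
        differentiable_at_withinI)
next
  case (Suc m)
  then show ?case by (metis Ck.simps(2))
qed

lemma Ck_const [simp]: "Ck m (\<lambda>x. c)"
  by (induction m arbitrary: c) (auto simp: pd_const[abs_def])

lemma Ck_add: "Ck m f \<Longrightarrow> Ck m h \<Longrightarrow> Ck m (\<lambda>x. f x + h x)"
proof (induction m arbitrary: f h)
  case (Suc m)
  moreover have "pd i (\<lambda>x. f x + h x) = (\<lambda>x. pd i f x + pd i h x)" for i
    using Suc.prems by (auto simp: pd_add)
  ultimately show ?case by auto
qed (auto intro: continuous_intros)

lemma Ck_mult: "Ck m f \<Longrightarrow> Ck m h \<Longrightarrow> Ck m (\<lambda>x. f x * h x)"
proof (induction m arbitrary: f h)
  case (Suc m)
  have "pd i (\<lambda>x. f x * h x) = (\<lambda>x. pd i f x * h x + f x * pd i h x)" for i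
    using Suc.prems by (auto simp: pd_mult)
  moreover have "Ck m f" "Ck m h" "Ck m (pd i f)" "Ck m (pd i h)" for i
    using Suc.prems Ck_SucD by auto
  then have "Ck m (\<lambda>x. pd i f x * h x + f x * pd i h x)" for i
    by (intro Ck_add Suc.IH)
  ultimately show ?case using Suc.prems by auto
qed (auto intro: continuous_intros)

lemma Ck_inverse:
  assumes "\<And>x. f x \<noteq> 0"
  shows "Ck m f \<Longrightarrow> Ck m (\<lambda>x. inverse (f x))"
proof (induction m)
  case (Suc m)
  have d: "f differentiable (at x)" for x
    using Suc.prems by simp
  have "pd i (\<lambda>x. inverse (f x)) = (\<lambda>x. (- 1) * (pd i f x * (inverse (f x) * inverse (f x))))" for i
    using d assms by (auto simp: pd_inverse)
  moreover have "Ck m (\<lambda>x. (- 1) * (pd i f x * (inverse (f x) * inverse (f x))))" for i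
    using Suc.prems Ck_SucD[OF Suc.prems] by (intro Ck_mult Suc.IH Ck_const) auto
  moreover have "(\<lambda>x. inverse (f x)) differentiable (at x)" for x
    using d assms by (auto intro: differentiable_inverse)
  ultimately show ?case by simp
qed (auto intro!: continuous_intros assms)

lemma Ck_exp_coord: "Ck m (\<lambda>x. exp (c * x $ j))"
proof (induction m)
  case (Suc m)
  have "pd i (\<lambda>x. exp (c * x $ j)) = (if i = j then (\<lambda>x. c * exp (c * x $ j)) else (\<lambda>x. 0))" for i
    by (auto simp: pd_exp_coord)
  moreover have "Ck m (\<lambda>x. c * exp (c * x $ j))"
    by (intro Ck_mult Ck_const Suc.IH)
  moreover have "(\<lambda>x. exp (c * x $ j)) differentiable (at x)" for x
    using has_derivative_exp_coord differentiable_def by blast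
  ultimately show ?case by simp
qed (auto intro!: continuous_intros)

lemma smooth_const [simp]: "smooth (\<lambda>x. c)"
  by (simp add: smooth_def)

lemma smooth_add: "smooth f \<Longrightarrow> smooth h \<Longrightarrow> smooth (\<lambda>x. f x + h x)"
  by (simp add: smooth_def Ck_add)

lemma smooth_mult: "smooth f \<Longrightarrow> smooth h \<Longrightarrow> smooth (\<lambda>x. f x * h x)"
  by (simp add: smooth_def Ck_mult)

lemma smooth_minus: "smooth f \<Longrightarrow> smooth (\<lambda>x. - f x)"
  using smooth_mult[of "\<lambda>x. - 1" f] by simp

lemma smooth_diff: "smooth f \<Longrightarrow> smooth h \<Longrightarrow> smooth (\<lambda>x. f x - h x)"
  using smooth_add[of f "\<lambda>x. - h x"] smooth_minus[of h] by simp

lemma smooth_inverse: "smooth f \<Longrightarrow> (\<And>x. f x \<noteq> 0) \<Longrightarrow> smooth (\<lambda>x. inverse (f x))"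
  by (simp add: smooth_def Ck_inverse)

lemma smooth_exp_coord: "smooth (\<lambda>x. exp (c * x $ j))"
  by (simp add: smooth_def Ck_exp_coord)

lemma smooth_sum: "finite A \<Longrightarrow> (\<And>m. m \<in> A \<Longrightarrow> smooth (f m)) \<Longrightarrow> smooth (\<lambda>x. \<Sum>m\<in>A. f m x)"
  by (induction A rule: finite_induct) (auto intro: smooth_add)

lemma smooth_differentiable: "smooth f \<Longrightarrow> f differentiable (at x)"
  unfolding smooth_def by (meson Ck_differentiable)

lemma smooth_pd: "smooth f \<Longrightarrow> smooth (pd i f)"
  unfolding smooth_def using Ck.simps(2) by blast

lemma smooth_continuous: "smooth f \<Longrightarrow> continuous_on UNIV f"
  unfolding smooth_def using Ck.simps(1) by blast

lemma DERIV_along_axis: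
  fixes f :: "real ^ 'n::finite \<Rightarrow> real"
  assumes "\<And>x. f differentiable (at x)"
  shows "((\<lambda>u. f (y + u *\<^sub>R axis i 1)) has_real_derivative pd i f (y + u *\<^sub>R axis i 1)) (at u)"
proof -
  let ?z = "y + u *\<^sub>R axis i 1"
  have "((\<lambda>u. y + u *\<^sub>R axis i 1) has_derivative (\<lambda>h. h *\<^sub>R axis i 1)) (at u)"
    by (auto intro!: derivative_eq_intros)
  from has_derivative_compose[OF this has_derivative_frechet[OF assms]]
  have "((\<lambda>u. f (y + u *\<^sub>R axis i 1)) has_derivative
      (\<lambda>h. frechet_derivative f (at ?z) (h *\<^sub>R axis i 1))) (at u)" .
  moreover have "(\<lambda>h. frechet_derivative f (at ?z) (h *\<^sub>R axis i 1)) = (\<lambda>h. pd i f ?z * h)"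
    using linear_frechet_derivative[OF assms] by (auto simp: pd_def linear_cmul)
  ultimately show ?thesis
    by (simp add: has_field_derivative_def)
qed

text \<open>The mean value theorem, used along \<open>axis i 1\<close> for the difference of
  \<open>f\<close> across a step in direction \<open>j\<close>, then along \<open>axis j 1\<close>
  for \<open>pd i f\<close>. The difference on the left is symmetric in \<open>i\<close> and
  \<open>j\<close>, which is what \<open>pd_commute\<close> exploits.\<close>

lemma second_difference:
  fixes f :: "real ^ 'n::finite \<Rightarrow> real"
  assumes f: "\<And>x. f differentiable (at x)" and fi: "\<And>x. pd i f differentiable (at x)" and h: "h > 0"
  shows "\<exists>u v. 0 < u \<and> u < h \<and> 0 < v \<and> v < h \<and>
    f (x + h *\<^sub>R axis i 1 + h *\<^sub>R axis j 1) - f (x + h *\<^sub>R axis i 1) - f (x + h *\<^sub>R axis j 1) + f x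
      = h * h * pd j (pd i f) (x + u *\<^sub>R axis i 1 + v *\<^sub>R axis j 1)"
proof -
  let ?i = "axis i 1 :: real ^ 'n" and ?j = "axis j 1 :: real ^ 'n"
  let ?p = "\<lambda>u. f (x + h *\<^sub>R ?j + u *\<^sub>R ?i) - f (x + u *\<^sub>R ?i)"
  have "\<exists>u. 0 < u \<and> u < h \<and>
      ?p h - ?p 0 = (h - 0) * (pd i f (x + h *\<^sub>R ?j + u *\<^sub>R ?i) - pd i f (x + u *\<^sub>R ?i))"
    by (rule MVT2[OF h]) (intro DERIV_diff DERIV_along_axis f)
  then obtain u where u: "0 < u" "u < h"
    "?p h - ?p 0 = h * (pd i f (x + h *\<^sub>R ?j + u *\<^sub>R ?i) - pd i f (x + u *\<^sub>R ?i))" by auto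
  let ?q = "\<lambda>v. pd i f ((x + u *\<^sub>R ?i) + v *\<^sub>R ?j)"
  have "\<exists>v. 0 < v \<and> v < h \<and> ?q h - ?q 0 = (h - 0) * pd j (pd i f) ((x + u *\<^sub>R ?i) + v *\<^sub>R ?j)"
    by (rule MVT2[OF h]) (intro DERIV_along_axis fi)
  then obtain v where v: "0 < v" "v < h"
    "?q h - ?q 0 = h * pd j (pd i f) ((x + u *\<^sub>R ?i) + v *\<^sub>R ?j)" by auto
  have "?p h - ?p 0 = h * (?q h - ?q 0)"
    using u(3) by (simp add: algebra_simps)
  then have "?p h - ?p 0 = h * h * pd j (pd i f) ((x + u *\<^sub>R ?i) + v *\<^sub>R ?j)"
    unfolding v(3) by simp
  then show ?thesis
    using u v by (intro exI[of _ u] exI[of _ v]) (auto simp: algebra_simps)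
qed

lemma pd_commute:
  assumes "smooth f"
  shows "pd i (pd j f) x = pd j (pd i f) x"
proof (rule ccontr)
  assume ne: "pd i (pd j f) x \<noteq> pd j (pd i f) x"
  \<comment> \<open>Both mixed partials at \<open>x\<close> will lie within \<open>e\<close> of one
    common value, so half the gap gives the contradiction.\<close>
  define e where "e = \<bar>pd i (pd j f) x - pd j (pd i f) x\<bar> / 2"
  have e: "e > 0" using ne by (simp add: e_def)
  have "continuous_on UNIV (pd i (pd j f))" "continuous_on UNIV (pd j (pd i f))"
    using assms by (intro smooth_continuous smooth_pd; simp)+
  then have cont: "continuous (at x) (pd i (pd j f))" "continuous (at x) (pd j (pd i f))"
    by (simp_all add: continuous_on_eq_continuous_at)
  obtain d1 where d1: "d1 > 0" "\<And>y. dist y x < d1 \<Longrightarrow> dist (pd i (pd j f) y) (pd i (pd j f) x) < e"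
    using cont(1) e unfolding continuous_at_eps_delta by (auto simp: dist_norm)
  obtain d2 where d2: "d2 > 0" "\<And>y. dist y x < d2 \<Longrightarrow> dist (pd j (pd i f) y) (pd j (pd i f) x) < e"
    using cont(2) e unfolding continuous_at_eps_delta by (auto simp: dist_norm)
  \<comment> \<open>The intermediate points are within \<open>u + v < 2 * h\<close> of
    \<open>x\<close>, hence inside both balls.\<close>
  define h where "h = min d1 d2 / 3"
  have h: "h > 0" using d1 d2 by (simp add: h_def)
  have near: "dist (x + u *\<^sub>R axis a 1 + v *\<^sub>R axis b 1) x < d1 \<and>
      dist (x + u *\<^sub>R axis a 1 + v *\<^sub>R axis b 1) x < d2"
    if "0 < u" "u < h" "0 < v" "v < h" for u v a b
  proof -
    have "dist (x + u *\<^sub>R axis a 1 + v *\<^sub>R axis b 1) x \<le> u + v"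
      using norm_triangle_ineq[of "u *\<^sub>R axis a 1" "v *\<^sub>R axis b (1::real)"] that
      by (auto simp: dist_norm norm_axis_1)
    then show ?thesis using that by (auto simp: h_def min_def split: if_splits)
  qed
  let ?D = "\<lambda>i j. f (x + h *\<^sub>R axis i 1 + h *\<^sub>R axis j 1) - f (x + h *\<^sub>R axis i 1)
     - f (x + h *\<^sub>R axis j 1) + f x"
  have diff: "f differentiable (at x)" "pd a f differentiable (at x)" for x a
    using assms by (auto intro: smooth_differentiable smooth_pd)
  obtain u v where 1: "0 < u" "u < h" "0 < v" "v < h"
    "?D i j = h * h * pd j (pd i f) (x + u *\<^sub>R axis i 1 + v *\<^sub>R axis j 1)"
    using second_difference[OF diff h] by blast
  obtain u' v' where 2: "0 < u'" "u' < h" "0 < v'" "v' < h"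
    "?D j i = h * h * pd i (pd j f) (x + u' *\<^sub>R axis j 1 + v' *\<^sub>R axis i 1)"
    using second_difference[OF diff h] by blast
  have "?D i j = ?D j i" by (simp add: algebra_simps)
  then have "pd j (pd i f) (x + u *\<^sub>R axis i 1 + v *\<^sub>R axis j 1)
      = pd i (pd j f) (x + u' *\<^sub>R axis j 1 + v' *\<^sub>R axis i 1)"
    using 1(5) 2(5) h by simp
  then show False
    using d1(2)[OF conjunct1[OF near[OF 2(1-4)]], of j i]
      d2(2)[OF conjunct2[OF near[OF 1(1-4)]], of i j]
    unfolding e_def dist_real_def by (simp add: abs_if split: if_splits)
qed

lemma pd_zero_const:
  fixes f :: "real ^ 'n::finite \<Rightarrow> real"
  assumes f: "\<And>x. f differentiable (at x)" and 0: "\<And>i x. pd i f x = 0"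
  shows "f x = f y"
proof -
  have "(f has_derivative (\<lambda>h. 0)) (at x)" for x
  proof -
    let ?F = "frechet_derivative f (at x)"
    have lin: "linear ?F" by (rule linear_frechet_derivative[OF f])
    have "?F v = 0" for v
    proof -
      have "?F v = ?F (\<Sum>i\<in>UNIV. v $ i *\<^sub>R axis i 1)"
        by (simp add: basis_expansion flip: scalar_mult_eq_scaleR)
      also have "\<dots> = (\<Sum>i\<in>UNIV. v $ i *\<^sub>R ?F (axis i 1))"
        by (simp add: linear_sum[OF lin] linear_cmul[OF lin])
      finally show ?thesis using 0 by (simp add: pd_def)
    qed
    then have "?F = (\<lambda>h. 0)" by auto
    then show ?thesis
      using has_derivative_frechet[OF f, of x] by simp
  qed
  then show ?thesis
    using Derivative.has_derivative_zero_unique[of UNIV f x y] by auto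
qed

text \<open>The product of \<open>f\<close> with the integrating factor
  \<open>exp (- c * x $ j)\<close> is constant, so one zero forces all others.\<close>

lemma pd_eigen_zero:
  fixes f :: "real ^ 'n::finite \<Rightarrow> real"
  assumes f: "\<And>x. f differentiable (at x)"
    and pd: "\<And>i x. pd i f x = (if i = j then c * f x else 0)"
    and 0: "f y = 0"
  shows "f x = 0"
proof -
  have d: "(\<lambda>x. exp (- c * x $ j)) differentiable (at x)" for x :: "real ^ 'n"
    by (rule smooth_differentiable[OF smooth_exp_coord])
  have "f x * exp (- c * x $ j) = f y * exp (- c * y $ j)"
  proof (rule pd_zero_const)
    show "(\<lambda>x. f x * exp (- c * x $ j)) differentiable (at x)" for x
      using f d by (rule differentiable_mult)
    show "pd i (\<lambda>x. f x * exp (- c * x $ j)) x = 0" for i x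
      using pd_mult[OF f d] by (simp add: pd pd_exp_coord[of _ "- c", simplified])
  qed
  then show ?thesis using 0 by simp
qed

text \<open>Duality makes the \<open>b i\<close> independent. Subtracting from \<open>a\<close> the
  combination with coefficients \<open>f j a\<close> leaves an element killed by every
  \<open>f i\<close>, so they span as well. Finite dimension is a conclusion here, as a solution
  space of differential equations requires.\<close>

lemma (in vector_space) dim_eq_card_dual_family:
  assumes I: "finite I" and V: "subspace V" and bV: "\<And>i. i \<in> I \<Longrightarrow> b i \<in> V"
    and add: "\<And>i x y. i \<in> I \<Longrightarrow> f i (x + y) = f i x + f i y"
    and scl: "\<And>i c x. i \<in> I \<Longrightarrow> f i (scale c x) = c * f i x"
    and dual: "\<And>i j. i \<in> I \<Longrightarrow> j \<in> I \<Longrightarrow> f i (b j) = (if i = j then 1 else 0)"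
    and ker: "\<And>a. a \<in> V \<Longrightarrow> (\<And>i. i \<in> I \<Longrightarrow> f i a = 0) \<Longrightarrow> a = 0"
  shows "dim V = card I"
proof -
  have f0: "f i 0 = 0" if "i \<in> I" for i
    using scl[OF that, of 0 0] by simp
  have fsum: "f i (\<Sum>j\<in>J. scale (c j) (b j)) = (\<Sum>j\<in>J. c j * f i (b j))"
    if "finite J" "i \<in> I" for i c J
    using that by (induction J rule: finite_induct) (auto simp: f0 add scl)
  have comb: "f i (\<Sum>j\<in>I. scale (c j) (b j)) = c i" if "i \<in> I" for i c
  proof -
    have "(\<Sum>j\<in>I. c j * f i (b j)) = (\<Sum>j\<in>I. if j = i then c j else 0)"
      by (rule sum.cong) (auto simp: dual that)
    then show ?thesis using that I by (simp add: fsum)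
  qed
  have inj: "inj_on b I"
  proof (rule inj_onI)
    fix i j assume ij: "i \<in> I" "j \<in> I" "b i = b j"
    have "f i (b j) = 1" using dual[of i i] ij by simp
    then show "i = j" using dual[of i j] ij by (auto split: if_splits)
  qed
  have ind: "independent (b ` I)"
  proof (rule independent_if_scalars_zero)
    fix u x assume *: "(\<Sum>x\<in>b ` I. scale (u x) x) = 0" and "x \<in> b ` I"
    then obtain i where i: "i \<in> I" "x = b i" by auto
    have "(\<Sum>j\<in>I. scale (u (b j)) (b j)) = 0"
      using * by (simp add: sum.reindex[OF inj])
    then show "u x = 0"
      using comb[OF i(1), of "\<lambda>j. u (b j)"] f0 i by simp
  qed (use I in simp)
  have "V \<subseteq> span (b ` I)"
  proof
    fix a assume a: "a \<in> V"
    let ?s = "\<Sum>j\<in>I. scale (f j a) (b j)"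
    have s: "?s \<in> V" by (intro subspace_sum V subspace_scale bV)
    have "a + scale (- 1) ?s = 0"
    proof (rule ker)
      show "a + scale (- 1) ?s \<in> V"
        using V a s by (intro subspace_add subspace_scale)
      show "f i (a + scale (- 1) ?s) = 0" if "i \<in> I" for i
        using that by (simp only: add scl comb) simp
    qed
    then have "a = ?s" by (simp add: add_eq_0_iff2)
    moreover have "?s \<in> span (b ` I)"
      by (intro span_sum span_scale span_base) auto
    ultimately show "a \<in> span (b ` I)" by simp
  qed
  moreover have "b ` I \<subseteq> V" using bV by auto
  ultimately have "span (b ` I) = span V"
    using V by (metis span_mono span_eq_iff subset_antisym)
  from dim_eq_card[OF this ind] show ?thesis
    by (simp add: card_image[OF inj])
qed

subsection \<open>Products of cones and a geodesically equivalent metric\<close>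

lemma sum_if_mult:
  fixes F a :: "'n::finite \<Rightarrow> real"
  shows "(\<Sum>m\<in>UNIV. (if i = m then a m else 0) * F m) = a i * F i"
    "(\<Sum>m\<in>UNIV. F m * (if m = i then a m else 0)) = F i * a i"
proof -
  have "(if i = m then a m else 0) * F m = (if m = i then a m * F m else 0)"
    "F m * (if m = i then a m else 0) = (if m = i then F m * a m else 0)" for m
    by auto
  then show "(\<Sum>m\<in>UNIV. (if i = m then a m else 0) * F m) = a i * F i"
    "(\<Sum>m\<in>UNIV. F m * (if m = i then a m else 0)) = F i * a i"
    by simp_all
qed

lemma diag_mult_diag:
  fixes a b :: "'n::finite \<Rightarrow> real"
  shows "(\<chi> i j. if i = j then a i else 0) ** (\<chi> i j. if i = j then b i else 0)
    = (\<chi> i j. if i = j then a i * b i else 0)"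
proof -
  have *: "(if i = j then u i else 0) = (if i = j then u j else 0)" for u :: "'n \<Rightarrow> real" and i j
    by simp
  show ?thesis
    by (simp add: matrix_matrix_mult_def vec_eq_iff *[of _ _ a] sum_if_mult)
qed

lemma matrix_inv_eqI:
  fixes A B :: "real ^ 'n::finite ^ 'n"
  assumes "A ** B = mat 1"
  shows "invertible A" "matrix_inv A = B"
proof -
  have BA: "B ** A = mat 1" using assms matrix_left_right_inverse by blast
  then show "invertible A" using assms invertible_def by blast
  then have "matrix_inv A ** A = mat 1"
    unfolding invertible_def matrix_inv_def by (rule someI2_ex) simp
  then show "matrix_inv A = B"
    by (metis assms matrix_mul_assoc matrix_mul_lid matrix_mul_rid)
qed

text \<open>Koszul's argument: a symmetric connection that annihilates \<open>g\<close> is the Levi-Civita one.\<close>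

lemma christoffel_eqI:
  fixes g :: "'n::finite tensor2"
  assumes inv: "invertible (g x)" and sym: "sym_tensor2 g"
    and tors: "\<And>i j k. G i j k = G i k j"
    and compat: "\<And>i j k. pd k (\<lambda>y. g y $ i $ j) x =
      (\<Sum>m\<in>UNIV. G m k i * g x $ m $ j) + (\<Sum>m\<in>UNIV. G m k j * g x $ i $ m)"
  shows "christoffel g x i j k = G i j k"
proof -
  have g_sym: "g y $ a $ b = g y $ b $ a" for y a b
    using sym unfolding sym_tensor2_def transpose_def by (metis vec_lambda_beta)
  \<comment> \<open>Compatibility turns the three derivatives into six sums; four cancel in pairs by
    symmetry of \<open>G\<close> in its lower indices, and the other two agree, whence the factor
    2.\<close>
  have 1: "pd j (\<lambda>y. g y $ m $ k) x + pd k (\<lambda>y. g y $ m $ j) x - pd m (\<lambda>y. g y $ j $ k) x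
      = 2 * (\<Sum>l\<in>UNIV. g x $ m $ l * G l j k)" for m
  proof -
    have "(\<Sum>l\<in>UNIV. G l j m * g x $ l $ k) = (\<Sum>l\<in>UNIV. G l m j * g x $ l $ k)"
      "(\<Sum>l\<in>UNIV. G l k m * g x $ l $ j) = (\<Sum>l\<in>UNIV. G l m k * g x $ j $ l)"
      "(\<Sum>l\<in>UNIV. G l k j * g x $ m $ l) = (\<Sum>l\<in>UNIV. g x $ m $ l * G l j k)"
      "(\<Sum>l\<in>UNIV. G l j k * g x $ m $ l) = (\<Sum>l\<in>UNIV. g x $ m $ l * G l j k)"
      by (auto intro!: sum.cong simp: tors[of _ j m] tors[of _ k m] tors[of _ k j] g_sym[of x j])
    then show ?thesis
      unfolding compat by simp
  qed
  have 2: "(\<Sum>m\<in>UNIV. matrix_inv (g x) $ i $ m * g x $ m $ l) = (if i = l then 1 else 0)" for l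
  proof -
    have "matrix_inv (g x) ** g x = mat 1"
      using inv unfolding invertible_def matrix_inv_def by (rule someI2_ex) simp
    from arg_cong[OF this, of "\<lambda>A. A $ i $ l"] show ?thesis
      by (simp add: matrix_matrix_mult_def mat_def)
  qed
  have "(\<Sum>m\<in>UNIV. matrix_inv (g x) $ i $ m * (2 * (\<Sum>l\<in>UNIV. g x $ m $ l * G l j k)))
      = 2 * (\<Sum>m\<in>UNIV. \<Sum>l\<in>UNIV. matrix_inv (g x) $ i $ m * g x $ m $ l * G l j k)"
    by (simp add: sum_distrib_left mult.assoc mult.left_commute)
  also have "\<dots> = 2 * (\<Sum>l\<in>UNIV. (\<Sum>m\<in>UNIV. matrix_inv (g x) $ i $ m * g x $ m $ l) * G l j k)"
    by (subst sum.swap) (simp add: sum_distrib_right)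
  also have "\<dots> = 2 * G i j k"
    unfolding 2 by (simp add: sum_if_mult)
  finally show ?thesis
    unfolding christoffel_def 1 by simp
qed

text \<open>The coordinates \<open>x\<^sub>i\<close> with \<open>tau i = t\<close>, where \<open>tau t = t\<close>, form one factor: the cone with radius
  \<open>exp x\<^sub>t\<close> over the flat space of the remaining ones. The last assumption excludes factors of
  dimension 2, which would be flat; the coordinate \<open>neg\<close> is the timelike one.\<close>

locale cone_product =
  fixes tau :: "'n::finite \<Rightarrow> 'n" and neg :: 'n
  assumes tau_idem [simp]: "tau (tau i) = tau i"
    and neg: "tau neg \<noteq> neg"
    and two: "tau p \<noteq> p \<Longrightarrow> \<exists>q. q \<noteq> p \<and> tau q \<noteq> q \<and> tau q = tau p"
begin

definition sg :: "'n \<Rightarrow> real"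
  where "sg i = (if i = neg then - 1 else 1)"

definition r :: "'n \<Rightarrow> real ^ 'n \<Rightarrow> real"
  where "r i x = exp (x $ tau i)"

definition g :: "'n tensor2"
  where "g x = (\<chi> i j. if i = j then sg i * (r i x * r i x) else 0)"

text \<open>The formula for a conformally flat metric e^(2f) eta: Gamma^i_jk = delta^i_j f_k +
  delta^i_k f_j - eta_jk f^i, where \<open>f\<close> is the coordinate \<open>x $ tau i\<close> of
  the factor. Its differential has constant components, hence so has the connection.\<close>

definition gam :: "'n \<Rightarrow> 'n \<Rightarrow> 'n \<Rightarrow> real"
  where "gam i j k = (if i = j \<and> k = tau i then 1 else 0) + (if i = k \<and> j = tau i then 1 else 0)
    - (if j = k \<and> i = tau j then sg j else 0)"

text \<open>\<open>xi\<close> is dual to the homothetic field \<open>\<Sum> \<partial>\<^sub>t\<close> over all \<open>t\<close> with \<open>tau t = t\<close>, and \<open>rho\<close> is the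
  square of its length.\<close>

definition xi :: "real ^ 'n \<Rightarrow> 'n \<Rightarrow> real"
  where "xi x i = (if tau i = i then r i x * r i x else 0)"

definition rho :: "real ^ 'n \<Rightarrow> real"
  where "rho x = (\<Sum>i\<in>UNIV. xi x i)"

definition s :: "real ^ 'n \<Rightarrow> real"
  where "s x = inverse (1 + rho x)"

text \<open>Since 1 - s rho = s, det h = s^(n+1) det g. Therefore (det h / det g)^(1/(n+1)) times
  the inverse of \<open>h\<close> equals g + xi xi with both indices raised by \<open>g\<close>: the
  standard passage from a solution to a metric.\<close>

definition h :: "'n tensor2"
  where "h x = (\<chi> i j. s x * g x $ i $ j - s x * s x * (xi x i * xi x j))"

text \<open>A change of connection by delta^i_j psi_k + delta^i_k psi_j, Weyl's form of a change
  that keeps unparametrized geodesics. Here psi = - s xi = - (1/2) d log (1 + rho).\<close>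

definition gamh :: "real ^ 'n \<Rightarrow> 'n \<Rightarrow> 'n \<Rightarrow> 'n \<Rightarrow> real"
  where "gamh x i j k = gam i j k - (if i = j then s x * xi x k else 0) - (if i = k then s x * xi x j else 0)"

lemma sg_sq [simp]: "sg i * sg i = 1"
  by (simp add: sg_def)

lemma sg_nz [simp]: "sg i \<noteq> 0"
  by (simp add: sg_def)

lemma sg_top [simp]: "sg (tau i) = 1"
  using neg by (auto simp: sg_def)

lemma sg_top': "tau i = i \<Longrightarrow> sg i = 1"
  using sg_top by metis

lemma r_nz [simp]: "r i x \<noteq> 0"
  by (simp add: r_def)

lemma r_tau [simp]: "r (tau i) = r i"
  by (simp add: r_def fun_eq_iff)

lemma smooth_r: "smooth (r i)"
  using smooth_exp_coord[of 1 "tau i"] by (simp add: r_def[abs_def])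

lemma diff_r: "r i differentiable (at x)"
  by (rule smooth_differentiable[OF smooth_r])

lemma pd_r: "pd k (r i) x = (if k = tau i then r i x else 0)"
  using pd_exp_coord[of k 1 "tau i"] by (simp add: r_def[abs_def])

lemma pd_rr: "pd k (\<lambda>x. r i x * r j x) x =
   (if k = tau i then r i x * r j x else 0) + (if k = tau j then r i x * r j x else 0)"
  by (simp add: pd_mult diff_r pd_r)

lemma gam_sum:
  "(\<Sum>m\<in>UNIV. gam m k i * F m) =
    (if i = tau k then F k else 0) + (if k = tau i then F i else 0)
    - (if k = i then sg k * F (tau k) else 0)"
proof -
  have "gam m k i * F m = (if m = k then (if i = tau k then F k else 0) else 0)
    + (if m = i then (if k = tau i then F i else 0) else 0)
    - (if m = tau k then (if k = i then sg k * F (tau k) else 0) else 0)" for m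
    by (simp add: gam_def algebra_simps)
  then show ?thesis by (simp add: sum.distrib sum_subtractf)
qed

lemma gam_sym: "gam i j k = gam i k j"
  by (auto simp: gam_def)

lemma g_smooth: "smooth (\<lambda>x. g x $ i $ j)"
  by (cases "i = j") (auto simp: g_def intro!: smooth_mult smooth_r)

lemma g_sym: "g x $ i $ j = g x $ j $ i"
  by (simp add: g_def)

lemma g_inverse:
  "g x ** (\<chi> i j. if i = j then sg i * (inverse (r i x) * inverse (r i x)) else 0) = mat 1"
  unfolding g_def diag_mult_diag by (simp add: mat_def vec_eq_iff field_simps)

lemma g_compat:
  "pd k (\<lambda>y. g y $ i $ j) x =
    (\<Sum>m\<in>UNIV. gam m k i * g x $ m $ j) + (\<Sum>m\<in>UNIV. gam m k j * g x $ i $ m)"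
proof (cases "i = j")
  case True
  have "pd k (\<lambda>y. g y $ i $ i) x = sg i * pd k (\<lambda>y. r i y * r i y) x"
    unfolding g_def by (simp, rule pd_cmult) (intro differentiable_mult diff_r)
  then have "pd k (\<lambda>y. g y $ i $ i) x = (if k = tau i then 2 * g x $ i $ i else 0)"
    by (simp add: pd_rr g_def)
  then show ?thesis
    unfolding gam_sum True[symmetric]
    by (cases "k = i"; cases "tau i = i") (simp_all add: g_def sg_top')
next
  case False
  then have "pd k (\<lambda>y. g y $ i $ j) x = 0"
    by (simp add: g_def)
  \<comment> \<open>Off the diagonal the right side has nonzero terms only when one index is
    \<open>k\<close> and the other \<open>tau k\<close>; there they cancel in pairs.\<close>
  moreover have "(if i = tau k then g x $ k $ j else 0) = (if k = j then sg k * g x $ i $ tau k else 0)"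
    using False by (cases "i = tau k") (auto simp: g_def)
  moreover have "(if j = tau k then g x $ i $ k else 0) = (if k = i then sg k * g x $ tau k $ j else 0)"
    using False by (cases "j = tau k") (auto simp: g_def)
  ultimately show ?thesis
    using False unfolding gam_sum by (simp add: g_def)
qed

lemma pseudo_riemannian_g: "pseudo_riemannian g"
  unfolding pseudo_riemannian_def smooth_tensor2_def sym_tensor2_def
  using g_smooth g_sym matrix_inv_eqI[OF g_inverse] by (auto simp: transpose_def vec_eq_iff)

lemma christoffel_g: "christoffel g x i j k = gam i j k"
  using pseudo_riemannian_g unfolding pseudo_riemannian_def
  by (intro christoffel_eqI gam_sym g_compat) auto

lemma lorentzian_g: "lorentzian g"
proof -
  have "has_signature (g x) 1 (CARD('n) - 1)" for x
    unfolding has_signature_def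
  proof (intro exI conjI)
    let ?P = "\<chi> i j. if i = j then inverse (r i x) else 0"
    have "?P ** (\<chi> i j. if i = j then r i x else 0) = mat 1"
      unfolding diag_mult_diag by (simp add: mat_def vec_eq_iff)
    then show "invertible ?P" by (rule matrix_inv_eqI)
    have "transpose ?P = ?P" by (simp add: transpose_def vec_eq_iff)
    then show "transpose ?P ** g x ** ?P =
        (\<chi> i j. if i = j then (if i \<in> {neg} then - 1 else 1) else 0)"
      unfolding g_def by (simp only: diag_mult_diag) (simp add: sg_def vec_eq_iff field_simps)
    show "card (- {neg}) = CARD('n) - 1"
      by (simp add: Compl_eq_Diff_UNIV card_Diff_subset)
  qed simp
  then show ?thesis using pseudo_riemannian_g by (simp add: lorentzian_def)
qed

section \<open>The homothetic form and the metric \<open>h\<close>\<close>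

lemma xi_smooth: "smooth (\<lambda>x. xi x i)"
  by (cases "tau i = i") (auto simp: xi_def intro!: smooth_mult smooth_r)

lemma xi_diff: "(\<lambda>x. xi x i) differentiable (at x)"
  by (rule smooth_differentiable[OF xi_smooth])

lemma pd_xi: "pd k (\<lambda>y. xi y i) x = (if k = i then 2 * xi x i else 0)"
  by (cases "tau i = i") (auto simp: xi_def pd_rr)

lemma cov_xi: "pd k (\<lambda>y. xi y i) x = g x $ i $ k + (\<Sum>m\<in>UNIV. gam m k i * xi x m)"
proof (cases "k = i")
  case True
  then show ?thesis
    unfolding gam_sum pd_xi by (cases "tau i = i") (simp_all add: xi_def g_def sg_top')
next
  case False
  then have "i = tau k \<Longrightarrow> xi x k = 0" "k = tau i \<Longrightarrow> xi x i = 0"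
    by (simp_all add: xi_def)
  then show ?thesis
    unfolding gam_sum pd_xi using False by (simp add: g_def)
qed

lemma rho_pos: "1 + rho x > 0"
proof -
  have "rho x \<ge> 0" unfolding rho_def by (rule sum_nonneg) (simp add: xi_def)
  then show ?thesis by simp
qed

lemma rho_nz [simp]: "1 + rho x \<noteq> 0"
  using rho_pos[of x] by simp

lemma s_rho: "s x * (1 + rho x) = 1"
  by (simp add: s_def)

lemma rho_smooth: "smooth (\<lambda>x. 1 + rho x)"
  unfolding rho_def by (intro smooth_add smooth_const smooth_sum xi_smooth) simp

lemma pd_rho: "pd k (\<lambda>x. 1 + rho x) x = 2 * xi x k"
proof -
  have d: "rho differentiable (at x)"
    using smooth_differentiable[OF rho_smooth, of x] differentiable_diff[of "\<lambda>x. 1 + rho x" _ "\<lambda>x. 1"]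
    by simp
  have "pd k rho x = (\<Sum>i\<in>UNIV. pd k (\<lambda>x. xi x i) x)"
    unfolding rho_def by (rule pd_sum) (rule xi_diff)
  then show ?thesis using d by (simp add: pd_add pd_xi)
qed

lemma s_smooth: "smooth s"
  unfolding s_def[abs_def] by (intro smooth_inverse rho_smooth) simp

lemma pd_s: "pd k s x = - (2 * xi x k * (s x * s x))"
  unfolding s_def[abs_def]
  by (subst pd_inverse) (simp_all add: smooth_differentiable[OF rho_smooth] pd_rho)

lemma h_smooth: "smooth (\<lambda>x. h x $ i $ j)"
  unfolding h_def by (simp, intro smooth_diff smooth_mult s_smooth xi_smooth g_smooth)

text \<open>Sherman-Morrison: \<open>h\<close> is \<open>s\<close> times the rank one update of
  \<open>g\<close> by - s xi xi, and 1 - s rho = s. The indicator is the component of X X, as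
  \<open>X\<close> has component 1 in each coordinate fixed by \<open>tau\<close>.\<close>

lemma h_inverse:
  "h x ** (\<chi> i j. (1 + rho x) * ((if i = j then sg i * (inverse (r i x) * inverse (r i x)) else 0)
      + (if tau i = i \<and> tau j = j then 1 else 0))) = mat 1"
proof -
  let ?e = "\<lambda>i. if tau i = i then 1 else 0 :: real"
  let ?k = "\<lambda>i j. if i = j then sg i * (inverse (r i x) * inverse (r i x)) else 0"
  have gk: "(\<Sum>m\<in>UNIV. g x $ i $ m * ?k m j) = (if i = j then 1 else 0)" for i j
    using arg_cong[OF g_inverse[of x], of "\<lambda>A. A $ i $ j"]
    by (simp add: matrix_matrix_mult_def mat_def)
  have xe: "(\<Sum>m\<in>UNIV. xi x m * ?e m) = rho x"
    unfolding rho_def by (rule sum.cong) (auto simp: xi_def)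
  have ge: "(\<Sum>m\<in>UNIV. g x $ i $ m * ?e m) = xi x i" for i
    unfolding g_def vec_lambda_beta
    using sum_if_mult(1)[of i "\<lambda>_. sg i * (r i x * r i x)" ?e] by (simp add: xi_def sg_top')
  have xk: "(\<Sum>m\<in>UNIV. xi x m * ?k m j) = ?e j" for j
    unfolding sum_if_mult by (simp add: xi_def sg_top' field_simps)
  have "(\<Sum>m\<in>UNIV. h x $ i $ m * ((1 + rho x) * (?k m j + ?e m * ?e j))) = (if i = j then 1 else 0)" for i j
  proof -
    have "(\<Sum>m\<in>UNIV. h x $ i $ m * ((1 + rho x) * (?k m j + ?e m * ?e j)))
      = (\<Sum>m\<in>UNIV. s x * (1 + rho x) * (g x $ i $ m * ?k m j) + s x * (1 + rho x) * ?e j * (g x $ i $ m * ?e m)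
          - s x * (1 + rho x) * s x * xi x i * (xi x m * ?k m j)
          - s x * (1 + rho x) * s x * xi x i * ?e j * (xi x m * ?e m))"
      by (rule sum.cong) (simp_all add: h_def algebra_simps del: if_split)
    also have "\<dots> = (if i = j then 1 else 0) + ?e j * xi x i - s x * xi x i * ?e j - s x * xi x i * ?e j * rho x"
      unfolding sum_subtractf sum.distrib sum_distrib_left[symmetric] gk xe ge xk s_rho by simp
    also have "\<dots> = (if i = j then 1 else 0) + ?e j * xi x i - (s x * (1 + rho x)) * (xi x i * ?e j)"
      by (simp add: algebra_simps del: if_split)
    finally show ?thesis by (simp add: s_rho)
  qed
  moreover have "(if tau i = i \<and> tau j = j then 1 else 0) = ?e i * ?e j" for i j
    by simp
  ultimately show ?thesis
    by (simp add: matrix_matrix_mult_def mat_def vec_eq_iff)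
qed

lemma pseudo_riemannian_h: "pseudo_riemannian h"
  unfolding pseudo_riemannian_def smooth_tensor2_def sym_tensor2_def
  using h_smooth g_sym matrix_inv_eqI[OF h_inverse]
  by (auto simp: transpose_def vec_eq_iff h_def)

lemma pd_h: "pd k (\<lambda>y. h y $ i $ j) x =
    pd k s x * g x $ i $ j + s x * pd k (\<lambda>y. g y $ i $ j) x
    - (2 * s x * pd k s x * (xi x i * xi x j)
      + s x * s x * (pd k (\<lambda>y. xi y i) x * xi x j + xi x i * pd k (\<lambda>y. xi y j) x))"
proof -
  note d = smooth_differentiable[OF s_smooth] smooth_differentiable[OF g_smooth] xi_diff
  show ?thesis
    unfolding h_def using d
    by (simp add: pd_diff pd_mult algebra_simps)
qed

lemma gamh_sum:
  "(\<Sum>m\<in>UNIV. gamh x m k i * F m) =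
    (\<Sum>m\<in>UNIV. gam m k i * F m) - s x * xi x i * F k - s x * xi x k * F i"
proof -
  have "gamh x m k i * F m = gam m k i * F m - (if m = k then s x * xi x i * F k else 0)
      - (if m = i then s x * xi x k * F i else 0)" for m
    by (simp add: gamh_def algebra_simps)
  then show ?thesis by (simp add: sum_subtractf)
qed

text \<open>With nabla g = 0, nabla xi = g and ds = - 2 s^2 xi both sides become the same polynomial
  in \<open>s\<close>, \<open>xi\<close> and \<open>g\<close>.\<close>

lemma h_compat:
  "pd k (\<lambda>y. h y $ i $ j) x =
    (\<Sum>m\<in>UNIV. gamh x m k i * h x $ m $ j) + (\<Sum>m\<in>UNIV. gamh x m k j * h x $ i $ m)"
proof -
  have 1: "(\<Sum>m\<in>UNIV. gam m k i * h x $ m $ j) =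
      s x * (\<Sum>m\<in>UNIV. gam m k i * g x $ m $ j) - s x * s x * (\<Sum>m\<in>UNIV. gam m k i * xi x m) * xi x j"
    by (simp add: h_def algebra_simps sum_subtractf sum_distrib_left)
  have 2: "(\<Sum>m\<in>UNIV. gam m k j * h x $ i $ m) =
      s x * (\<Sum>m\<in>UNIV. gam m k j * g x $ i $ m) - s x * s x * (\<Sum>m\<in>UNIV. gam m k j * xi x m) * xi x i"
    by (simp add: h_def algebra_simps sum_subtractf sum_distrib_left)
  have h: "h x $ a $ b = s x * g x $ a $ b - s x * s x * (xi x a * xi x b)" for a b
    by (simp add: h_def)
  show ?thesis
    unfolding pd_h pd_s cov_xi g_compat gamh_sum 1 2
    unfolding h by (simp add: algebra_simps g_sym[of x k])
qed

lemma christoffel_h: "christoffel h x i j k = gamh x i j k"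
  using pseudo_riemannian_h unfolding pseudo_riemannian_def
  by (intro christoffel_eqI h_compat) (auto simp: gamh_def gam_sym[of _ _ k for k])

lemma not_affinely_equivalent: "\<not> affinely_equivalent g h"
proof
  assume "affinely_equivalent g h"
  then have "christoffel g 0 (tau neg) (tau neg) (tau neg) = christoffel h 0 (tau neg) (tau neg) (tau neg)"
    by (simp add: affinely_equivalent_def)
  then have "s 0 * xi 0 (tau neg) = 0"
    by (simp add: christoffel_g christoffel_h gamh_def)
  then show False by (simp add: s_def xi_def)
qed

end

subsection \<open>Geodesic equivalence\<close>

text \<open>Provides the possibly infinite endpoints between which
  \<open>einterval_antiderivative\<close> works.\<close>

lemma open_interval_ereal_bounds:
  assumes "open_interval I"
  obtains a b :: ereal where "a < b" "\<And>t. t \<in> I \<longleftrightarrow> a < ereal t \<and> ereal t < b"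
proof -
  have I: "open I" "is_interval I" "I \<noteq> {}"
    using assms by (auto simp: open_interval_def)
  define a b where "a = Inf (ereal ` I)" and "b = Sup (ereal ` I)"
  have in_I: "a < ereal t \<and> ereal t < b" if t: "t \<in> I" for t
  proof -
    obtain e where e: "e > 0" "\<And>y. dist y t < e \<Longrightarrow> y \<in> I"
      using I(1) t unfolding open_dist by metis
    have "t - e / 2 \<in> I" "t + e / 2 \<in> I"
      using e(1) by (auto intro!: e(2) simp: dist_real_def)
    then have "a \<le> ereal (t - e / 2)" "ereal (t + e / 2) \<le> b"
      unfolding a_def b_def by (auto intro: INF_lower SUP_upper)
    moreover have "ereal (t - e / 2) < ereal t" "ereal t < ereal (t + e / 2)"
      using e(1) by simp_all
    ultimately show ?thesis
      by (meson le_less_trans less_le_trans)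
  qed
  moreover have "t \<in> I" if t: "a < ereal t \<and> ereal t < b" for t
  proof -
    obtain y z where "y \<in> I" "z \<in> I" "y < t" "t < z"
      using t INF_less_iff[of ereal I "ereal t"] less_SUP_iff[of "ereal t" ereal I]
      unfolding a_def b_def by auto
    then show ?thesis using I(2) unfolding is_interval_1 by (meson less_imp_le)
  qed
  moreover have "a < b"
    using I(3) in_I by (meson ex_in_conv less_trans)
  ultimately show ?thesis using that by blast
qed

text \<open>The equation phi' = Q(phi) is autonomous: its solution is the inverse of an
  antiderivative \<open>\<psi>\<close> of 1/Q, and \<open>J\<close> is the image of \<open>I\<close>
  under \<open>\<psi>\<close>.\<close>

lemma reparametrization_of_quadratic_speed:
  assumes I: "open_interval I" and pos: "\<And>t. t \<in> I \<Longrightarrow> poly Q t > 0"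
  obtains J \<phi> where "reparametrization J I \<phi>"
    "\<And>t. t \<in> J \<Longrightarrow> (\<phi> has_real_derivative poly Q (\<phi> t)) (at t)"
proof -
  have Io: "open I" "is_interval I" "I \<noteq> {}"
    using I by (auto simp: open_interval_def)
  obtain a b where ab: "a < b" "\<And>t. t \<in> I \<longleftrightarrow> a < ereal t \<and> ereal t < b"
    using open_interval_ereal_bounds[OF I] by blast
  have "\<exists>F. \<forall>t. a < ereal t \<longrightarrow> ereal t < b \<longrightarrow> (F has_vector_derivative inverse (poly Q t)) (at t)"
  proof (rule einterval_antiderivative[OF ab(1)])
    fix t assume "a < ereal t" "ereal t < b"
    then have "poly Q t > 0" using ab(2) pos by blast
    then show "isCont (\<lambda>t. inverse (poly Q t)) t" by (intro continuous_intros) auto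
  qed
  then obtain \<psi> where \<psi>: "\<And>t. t \<in> I \<Longrightarrow> (\<psi> has_real_derivative inverse (poly Q t)) (at t)"
    using ab(2) by (metis has_real_derivative_iff_has_vector_derivative)
  have mono: "\<psi> x < \<psi> y" if "x \<in> I" "y \<in> I" "x < y" for x y
  proof (rule DERIV_pos_imp_increasing[OF that(3)])
    fix t assume "x \<le> t" "t \<le> y"
    then have "t \<in> I" using Io(2) that unfolding is_interval_1 by blast
    then show "\<exists>d. (\<psi> has_real_derivative d) (at t) \<and> d > 0"
      using \<psi> pos by (meson positive_imp_inverse_positive)
  qed
  have inj: "inj_on \<psi> I"
    by (rule inj_onI) (metis less_irrefl mono not_less_iff_gr_or_eq)
  have cont: "continuous_on I \<psi>"
    using \<psi> by (meson DERIV_isCont continuous_at_imp_continuous_on)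
  define J where "J = \<psi> ` I"
  obtain \<phi> where hom: "homeomorphism I J \<psi> \<phi>"
    using invariance_of_domain_homeomorphism[OF Io(1) cont _ inj] unfolding J_def by auto
  have J: "open J" unfolding J_def by (rule invariance_of_domain[OF cont Io(1) inj])
  have oiJ: "open_interval J"
    using Io J cont unfolding open_interval_def is_interval_connected_1 J_def
    by (auto intro: connected_continuous_image)
  have \<phi>I: "\<phi> t \<in> I" if "t \<in> J" for t
    using hom that unfolding homeomorphism_def by auto
  have \<phi>': "(\<phi> has_real_derivative poly Q (\<phi> t)) (at t)" if t: "t \<in> J" for t
  proof -
    obtain e where e: "e > 0" "\<And>y. dist y t < e \<Longrightarrow> y \<in> J"
      using J t unfolding open_dist by metis
    have "(\<phi> has_real_derivative inverse (inverse (poly Q (\<phi> t)))) (at t)"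
    proof (rule DERIV_inverse_function[where a = "t - e" and b = "t + e"])
      show "inverse (poly Q (\<phi> t)) \<noteq> 0" using pos[OF \<phi>I[OF t]] by simp
      show "\<psi> (\<phi> y) = y" if "t - e < y" "y < t + e" for y
        using hom e(2)[of y] that unfolding homeomorphism_def by (auto simp: dist_real_def)
      have "continuous_on J \<phi>" using hom by (simp add: homeomorphism_def)
      then show "isCont \<phi> t" using J t by (simp add: continuous_on_eq_continuous_at)
    qed (use \<psi>[OF \<phi>I[OF t]] e in auto)
    then show ?thesis by simp
  qed
  \<comment> \<open>The derivative of p(phi) is (p' Q)(phi), so polynomials in phi are closed under
    differentiation; this yields all orders of smoothness.\<close>
  have iter: "\<exists>p. \<forall>t\<in>J. (deriv ^^ m) \<phi> t = poly p (\<phi> t)" for m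
  proof (induction m)
    case 0
    show ?case by (rule exI[of _ "[:0, 1:]"]) simp
  next
    case (Suc m)
    then obtain p where p: "\<And>t. t \<in> J \<Longrightarrow> (deriv ^^ m) \<phi> t = poly p (\<phi> t)" by blast
    have "(deriv ^^ Suc m) \<phi> t = poly (pderiv p * Q) (\<phi> t)" if t: "t \<in> J" for t
    proof -
      have "((\<lambda>t. poly p (\<phi> t)) has_real_derivative poly (pderiv p) (\<phi> t) * poly Q (\<phi> t)) (at t)"
        by (rule DERIV_chain2[OF poly_DERIV \<phi>'[OF t]])
      then have "((deriv ^^ m) \<phi> has_real_derivative poly (pderiv p) (\<phi> t) * poly Q (\<phi> t)) (at t)"
        by (rule has_field_derivative_transform_within_open[OF _ J t]) (simp add: p)
      then show ?thesis by (simp add: DERIV_imp_deriv)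
    qed
    then show ?case by blast
  qed
  have "(deriv ^^ m) \<phi> differentiable (at t)" if t: "t \<in> J" for m t
  proof -
    obtain p where p: "\<And>t. t \<in> J \<Longrightarrow> (deriv ^^ m) \<phi> t = poly p (\<phi> t)" using iter by blast
    have "((\<lambda>t. poly p (\<phi> t)) has_real_derivative poly (pderiv p) (\<phi> t) * poly Q (\<phi> t)) (at t)"
      by (rule DERIV_chain2[OF poly_DERIV \<phi>'[OF t]])
    then have "((deriv ^^ m) \<phi> has_real_derivative poly (pderiv p) (\<phi> t) * poly Q (\<phi> t)) (at t)"
      by (rule has_field_derivative_transform_within_open[OF _ J t]) (simp add: p)
    then show ?thesis unfolding real_differentiable_def by blast
  qed
  moreover have "deriv \<phi> t \<noteq> 0" if "t \<in> J" for t
    using DERIV_imp_deriv[OF \<phi>'[OF that]] pos[OF \<phi>I[OF that]] by simp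
  moreover have "bij_betw \<phi> J I"
    using hom unfolding homeomorphism_def bij_betw_def by (metis inj_on_inverseI)
  ultimately have "reparametrization J I \<phi>"
    using oiJ I unfolding reparametrization_def by blast
  then show ?thesis using \<phi>' that by blast
qed

lemma interval_constant_if_deriv_zero:
  fixes f :: "real \<Rightarrow> real"
  assumes "open_interval I" and "\<And>t. t \<in> I \<Longrightarrow> (f has_real_derivative 0) (at t)"
  obtains C where "\<And>t. t \<in> I \<Longrightarrow> f t = C"
proof -
  have "convex I" using assms(1) by (simp add: open_interval_def is_interval_convex_1)
  then have "\<exists>C. \<forall>t\<in>I. f t = C"
    by (rule has_field_derivative_zero_constant)
      (use assms(2) in \<open>auto intro: has_field_derivative_at_within\<close>)
  then show ?thesis using that by blast
qed

context cone_product
begin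

lemma gam_quad:
  "(\<Sum>j\<in>UNIV. \<Sum>k\<in>UNIV. gam i j k * u j * u k)
    = 2 * u i * u (tau i) - (\<Sum>k\<in>UNIV. if tau k = i then sg k * (u k * u k) else 0)"
proof -
  have inner: "(\<Sum>k\<in>UNIV. gam i j k * u j * u k) = (if j = i then u i * u (tau i) else 0)
    + (if j = tau i then u i * u (tau i) else 0) - (if tau j = i then sg j * (u j * u j) else 0)" for j
  proof -
    have "gam i j k * u j * u k = (if k = tau i then (if j = i then u i * u (tau i) else 0) else 0)
      + (if k = i then (if j = tau i then u i * u (tau i) else 0) else 0)
      - (if k = j then (if tau j = i then sg j * (u j * u j) else 0) else 0)" for k
      unfolding gam_def by (auto simp: algebra_simps)
    then show ?thesis by (simp add: sum.distrib sum_subtractf)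
  qed
  show ?thesis
    unfolding inner by (simp add: sum.distrib sum_subtractf)
qed

lemma sum_fibres:
  fixes F G :: "'n \<Rightarrow> real"
  shows "(\<Sum>i\<in>UNIV. F i * (\<Sum>k\<in>UNIV. if tau k = i then G k else 0)) = (\<Sum>k\<in>UNIV. F (tau k) * G k)"
proof -
  have "(\<Sum>i\<in>UNIV. F i * (\<Sum>k\<in>UNIV. if tau k = i then G k else 0))
    = (\<Sum>k\<in>UNIV. \<Sum>i\<in>UNIV. if i = tau k then F i * G k else 0)"
    by (subst sum.swap) (auto simp: sum_distrib_left intro!: sum.cong)
  then show ?thesis by simp
qed

text \<open>Along a geodesic \<open>c\<close> the function \<open>1 + rho (c t)\<close> is a quadratic polynomial in \<open>t\<close>,
  since its second derivative is twice the constant \<open>g(c', c')\<close>.\<close>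

lemma rho_quadratic_along_geodesic:
  assumes I: "open_interval I"
    and c: "\<And>t. t \<in> I \<Longrightarrow> (c has_vector_derivative v t) (at t)"
    and v: "\<And>t. t \<in> I \<Longrightarrow> (v has_vector_derivative
         (\<chi> i. - (\<Sum>j\<in>UNIV. \<Sum>k\<in>UNIV. gam i j k * v t $ j * v t $ k))) (at t)"
  obtains Q where "\<And>t. t \<in> I \<Longrightarrow> 1 + rho (c t) = poly Q t"
    "\<And>t. t \<in> I \<Longrightarrow> 2 * (\<Sum>i\<in>UNIV. xi (c t) i * v t $ i) = poly (pderiv Q) t"
proof -
  let ?S = "\<lambda>i t. \<Sum>k\<in>UNIV. if tau k = i then sg k * (v t $ k * v t $ k) else 0"
  have DR: "((\<lambda>t. r i (c t)) has_real_derivative r i (c t) * v t $ tau i) (at t)" if "t \<in> I" for i t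
  proof -
    have "((\<lambda>t. c t $ tau i) has_real_derivative v t $ tau i) (at t)"
      using bounded_linear.has_vector_derivative[OF bounded_linear_vec_nth c[OF that]]
      by (simp add: has_real_derivative_iff_has_vector_derivative)
    then show ?thesis unfolding r_def by (rule DERIV_fun_exp)
  qed
  have DV: "((\<lambda>t. v t $ i) has_real_derivative ?S i t - 2 * v t $ i * v t $ tau i) (at t)" if "t \<in> I" for i t
    using bounded_linear.has_vector_derivative[OF bounded_linear_vec_nth v[OF that], of i]
    by (simp add: has_real_derivative_iff_has_vector_derivative gam_quad)
  \<comment> \<open>\<open>lin\<close> is g(X, c') and \<open>en\<close> is g(c', c'). Then rho' = 2
    lin because xi = d rho / 2, lin' = en because nabla X = Id, and en' = 0 along a
    geodesic.\<close>
  define lin where "lin t = (\<Sum>i\<in>UNIV. xi (c t) i * v t $ i)" for t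
  define en where "en t = (\<Sum>i\<in>UNIV. sg i * (r i (c t) * r i (c t)) * (v t $ i * v t $ i))" for t
  have DX: "((\<lambda>t. xi (c t) i) has_real_derivative 2 * xi (c t) i * v t $ i) (at t)" if "t \<in> I" for i t
  proof (cases "tau i = i")
    case True
    have "((\<lambda>t. r i (c t) * r i (c t)) has_real_derivative
        r i (c t) * v t $ tau i * r i (c t) + r i (c t) * v t $ tau i * r i (c t)) (at t)"
      by (rule DERIV_mult[OF DR DR]) (rule that)+
    then show ?thesis using True by (simp add: xi_def algebra_simps)
  qed (simp add: xi_def)
  have Drho: "((\<lambda>t. 1 + rho (c t)) has_real_derivative 2 * lin t) (at t)" if "t \<in> I" for t
  proof -
    have "((\<lambda>t. 1 + (\<Sum>i\<in>UNIV. xi (c t) i)) has_real_derivative 0 + (\<Sum>i\<in>UNIV. 2 * xi (c t) i * v t $ i)) (at t)"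
      by (intro DERIV_add DERIV_const DERIV_sum DX that)
    then show ?thesis by (simp add: rho_def lin_def sum_distrib_left mult.assoc)
  qed
  have xi_tau: "xi y (tau k) = r k y * r k y" for y k
    by (simp add: xi_def)
  have Dlin: "(lin has_real_derivative en t) (at t)" if "t \<in> I" for t
  proof -
    have "(lin has_real_derivative
      (\<Sum>i\<in>UNIV. 2 * xi (c t) i * v t $ i * v t $ i + (?S i t - 2 * v t $ i * v t $ tau i) * xi (c t) i)) (at t)"
      unfolding lin_def by (intro DERIV_sum DERIV_mult DX DV that)
    also have "(\<Sum>i\<in>UNIV. 2 * xi (c t) i * v t $ i * v t $ i + (?S i t - 2 * v t $ i * v t $ tau i) * xi (c t) i)
      = (\<Sum>i\<in>UNIV. xi (c t) i * ?S i t)"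
      by (rule sum.cong) (auto simp: xi_def algebra_simps)
    also have "\<dots> = en t"
      unfolding sum_fibres xi_tau en_def by (rule sum.cong) auto
    finally show ?thesis .
  qed
  have Den: "(en has_real_derivative 0) (at t)" if "t \<in> I" for t
  proof -
    let ?R = "\<lambda>i. r i (c t)" and ?V = "\<lambda>i. v t $ i"
    have "((\<lambda>t. sg i * (r i (c t) * r i (c t)) * (v t $ i * v t $ i)) has_real_derivative
      (2 * sg i * ?R i * ?R i * ?V i * ?S i t - 2 * (sg i * ?R i * ?R i * ?V i * ?V i * ?V (tau i)))) (at t)" for i
      by (rule DERIV_cong, rule DERIV_mult[OF DERIV_cmult[OF DERIV_mult[OF DR[OF that] DR[OF that]]]
            DERIV_mult[OF DV[OF that] DV[OF that]]])
        (simp add: algebra_simps)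
    then have "(en has_real_derivative
      (\<Sum>i\<in>UNIV. 2 * sg i * ?R i * ?R i * ?V i * ?S i t - 2 * (sg i * ?R i * ?R i * ?V i * ?V i * ?V (tau i)))) (at t)"
      unfolding en_def by (rule DERIV_sum)
    \<comment> \<open>\<open>?S i\<close> collects the fibre over \<open>i\<close>. Regrouped by
      fibres the first sum becomes the second, since the radius is constant on a fibre and
      \<open>sg\<close> is 1 on its top.\<close>
    also have "(\<Sum>i\<in>UNIV. 2 * sg i * ?R i * ?R i * ?V i * ?S i t - 2 * (sg i * ?R i * ?R i * ?V i * ?V i * ?V (tau i))) = 0"
      unfolding sum_subtractf sum_fibres by (simp add: sum_subtractf[symmetric] algebra_simps)
    finally show ?thesis .
  qed
  obtain E where E: "\<And>t. t \<in> I \<Longrightarrow> en t = E"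
    using interval_constant_if_deriv_zero[OF I Den] by blast
  have "((\<lambda>t. lin t - E * t) has_real_derivative 0) (at t)" if "t \<in> I" for t
    using DERIV_diff[OF Dlin[OF that] DERIV_cmult_Id[of E]] E[OF that] by simp
  then obtain B where B: "\<And>t. t \<in> I \<Longrightarrow> lin t - E * t = B"
    using interval_constant_if_deriv_zero[OF I] by blast
  have "((\<lambda>t. (1 + rho (c t)) - poly [:0, 2 * B, E:] t) has_real_derivative 0) (at t)" if "t \<in> I" for t
  proof -
    have "2 * lin t - poly (pderiv [:0, 2 * B, E:]) t = 0"
      using B[OF that] by (simp add: pderiv_pCons algebra_simps)
    then show ?thesis using DERIV_diff[OF Drho[OF that] poly_DERIV] by metis
  qed
  then obtain A where A: "\<And>t. t \<in> I \<Longrightarrow> (1 + rho (c t)) - poly [:0, 2 * B, E:] t = A"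
    using interval_constant_if_deriv_zero[OF I] by blast
  show ?thesis
  proof (rule that[of "[:A, 2 * B, E:]"])
    show "1 + rho (c t) = poly [:A, 2 * B, E:] t" if "t \<in> I" for t
      using A[OF that] by simp
    show "2 * (\<Sum>i\<in>UNIV. xi (c t) i * v t $ i) = poly (pderiv [:A, 2 * B, E:]) t" if "t \<in> I" for t
      using B[OF that] by (simp add: pderiv_pCons lin_def algebra_simps)
  qed
qed

text \<open>On a velocity the change of connection is a multiple of the velocity itself, so that a
  change of parameter can absorb it.\<close>

lemma gamh_quad:
  "(\<Sum>j\<in>UNIV. \<Sum>k\<in>UNIV. gamh x i j k * u j * u k)
    = (\<Sum>j\<in>UNIV. \<Sum>k\<in>UNIV. gam i j k * u j * u k) - 2 * s x * (\<Sum>k\<in>UNIV. xi x k * u k) * u i"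
proof -
  have "gamh x i j k * u j * u k = gam i j k * u j * u k - (if i = j then s x * u i * (xi x k * u k) else 0)
    - (if i = k then s x * (xi x j * u j) * u i else 0)" for j k
    by (simp add: gamh_def algebra_simps)
  then have "(\<Sum>j\<in>UNIV. \<Sum>k\<in>UNIV. gamh x i j k * u j * u k) = (\<Sum>j\<in>UNIV. \<Sum>k\<in>UNIV. gam i j k * u j * u k)
    - (\<Sum>j\<in>UNIV. \<Sum>k\<in>UNIV. if i = j then s x * u i * (xi x k * u k) else 0)
    - (\<Sum>j\<in>UNIV. s x * (xi x j * u j) * u i)"
    by (simp add: sum_subtractf)
  also have "(\<Sum>j\<in>UNIV. \<Sum>k\<in>UNIV. if i = j then s x * u i * (xi x k * u k) else 0)
    = (\<Sum>k\<in>UNIV. s x * u i * (xi x k * u k))"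
    by (subst sum.swap) simp
  finally show ?thesis
    by (simp add: sum_distrib_left sum_distrib_right algebra_simps)
qed

lemma geodesically_equivalent: "geodesically_equivalent g h"
  unfolding geodesically_equivalent_def
proof (intro allI impI)
  fix I c assume "geodesic g I c"
  then obtain v where I: "open_interval I"
    and c: "\<And>t. t \<in> I \<Longrightarrow> (c has_vector_derivative v t) (at t)"
    and v: "\<And>t. t \<in> I \<Longrightarrow> (v has_vector_derivative
         (\<chi> i. - (\<Sum>j\<in>UNIV. \<Sum>k\<in>UNIV. gam i j k * v t $ j * v t $ k))) (at t)"
    unfolding geodesic_def christoffel_g by blast
  obtain Q where Q: "\<And>t. t \<in> I \<Longrightarrow> 1 + rho (c t) = poly Q t"
    "\<And>t. t \<in> I \<Longrightarrow> 2 * (\<Sum>i\<in>UNIV. xi (c t) i * v t $ i) = poly (pderiv Q) t"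
    using rho_quadratic_along_geodesic[OF I c v] by blast
  have pos: "poly Q t > 0" if "t \<in> I" for t
    using Q(1)[OF that] rho_pos[of "c t"] by simp
  obtain J \<phi> where rep: "reparametrization J I \<phi>"
    and \<phi>: "\<And>t. t \<in> J \<Longrightarrow> (\<phi> has_real_derivative poly Q (\<phi> t)) (at t)"
    using reparametrization_of_quadratic_speed[OF I pos] by blast
  have \<phi>I: "\<phi> t \<in> I" if "t \<in> J" for t
    using rep that unfolding reparametrization_def bij_betw_def by blast
  have "geodesic h J (c \<circ> \<phi>)"
    unfolding geodesic_def christoffel_h
  proof (intro conjI exI ballI)
    show "open_interval J" using rep by (simp add: reparametrization_def)
    fix t assume t: "t \<in> J"
    let ?w = "\<lambda>t. poly Q (\<phi> t) *\<^sub>R v (\<phi> t)"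
    note \<phi>t = \<phi>[OF t, unfolded has_real_derivative_iff_has_vector_derivative]
    show "(c \<circ> \<phi> has_vector_derivative ?w t) (at t)"
      by (rule vector_diff_chain_at[OF \<phi>t c[OF \<phi>I[OF t]]])
    let ?a = "\<chi> i. - (\<Sum>j\<in>UNIV. \<Sum>k\<in>UNIV. gam i j k * v (\<phi> t) $ j * v (\<phi> t) $ k)"
    have 1: "((\<lambda>t. v (\<phi> t)) has_vector_derivative poly Q (\<phi> t) *\<^sub>R ?a) (at t)"
      using vector_diff_chain_at[OF \<phi>t v[OF \<phi>I[OF t]]] by (simp add: o_def)
    have 2: "((\<lambda>t. poly Q (\<phi> t)) has_real_derivative poly (pderiv Q) (\<phi> t) * poly Q (\<phi> t)) (at t)"
      by (rule DERIV_chain2[OF poly_DERIV \<phi>[OF t]])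
    have "(?w has_vector_derivative
      (poly Q (\<phi> t) *\<^sub>R (poly Q (\<phi> t) *\<^sub>R ?a) + (poly (pderiv Q) (\<phi> t) * poly Q (\<phi> t)) *\<^sub>R v (\<phi> t))) (at t)"
      by (rule has_vector_derivative_scaleR[OF 2 1])
    also have "poly Q (\<phi> t) *\<^sub>R (poly Q (\<phi> t) *\<^sub>R ?a) + (poly (pderiv Q) (\<phi> t) * poly Q (\<phi> t)) *\<^sub>R v (\<phi> t)
      = (\<chi> i. - (\<Sum>j\<in>UNIV. \<Sum>k\<in>UNIV. gamh ((c \<circ> \<phi>) t) i j k * ?w t $ j * ?w t $ k))"
    proof -
      let ?q = "poly Q (\<phi> t)" and ?x = "c (\<phi> t)" and ?v = "\<lambda>i. v (\<phi> t) $ i"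
      \<comment> \<open>The speed Q(phi) is 1 + rho, the inverse of \<open>s\<close>. Thus the term
        2 s xi(u) u for u = Q v reduces to Q Q' v, which is what differentiating the factor Q(phi)
        contributes.\<close>
      have sq: "s ?x * ?q = 1" using s_rho[of ?x] Q(1)[OF \<phi>I[OF t]] by simp
      have "(\<Sum>j\<in>UNIV. \<Sum>k\<in>UNIV. gamh ?x i j k * (?q * ?v j) * (?q * ?v k))
        = ?q * ?q * (\<Sum>j\<in>UNIV. \<Sum>k\<in>UNIV. gam i j k * ?v j * ?v k) - ?q * (poly (pderiv Q) (\<phi> t) * ?v i)" for i
      proof -
        have "(\<Sum>j\<in>UNIV. \<Sum>k\<in>UNIV. gamh ?x i j k * (?q * ?v j) * (?q * ?v k))
          = ?q * ?q * (\<Sum>j\<in>UNIV. \<Sum>k\<in>UNIV. gamh ?x i j k * ?v j * ?v k)"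
          by (simp add: sum_distrib_left algebra_simps)
        also have "\<dots> = ?q * ?q * (\<Sum>j\<in>UNIV. \<Sum>k\<in>UNIV. gam i j k * ?v j * ?v k)
           - (s ?x * ?q) * ?q * (2 * (\<Sum>k\<in>UNIV. xi ?x k * ?v k)) * ?v i"
          unfolding gamh_quad by (simp add: algebra_simps)
        finally show ?thesis unfolding sq Q(2)[OF \<phi>I[OF t]] by simp
      qed
      then show ?thesis by (simp add: vec_eq_iff algebra_simps)
    qed
    finally show "(?w has_vector_derivative
      (\<chi> i. - (\<Sum>j\<in>UNIV. \<Sum>k\<in>UNIV. gamh ((c \<circ> \<phi>) t) i j k * ?w t $ j * ?w t $ k))) (at t)" .
  qed
  then show "\<exists>J \<phi>. reparametrization J I \<phi> \<and> geodesic h J (c \<circ> \<phi>)"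
    using rep by blast
qed

end

subsection \<open>Rigidity of the mobility equation\<close>

text \<open>\<open>A\<close> and \<open>W\<close> are the frame components of a solution and of its
  1-form. Passing to the frame removes the terms of \<open>gam\<close> with
  \<open>k = tau i\<close>, so that only \<open>r k\<close> remains as a variable coefficient. All
  information on the derivatives of \<open>W\<close> has to come from
  \<open>pd_commute\<close>.\<close>

locale frame_solution = cone_product +
  fixes A :: "'a \<Rightarrow> 'a \<Rightarrow> real ^ 'a \<Rightarrow> real" and W :: "'a \<Rightarrow> real ^ 'a \<Rightarrow> real"
  assumes A_smooth: "smooth (A i j)" and W_smooth: "smooth (W i)"
    and A_sym: "A i j = A j i"
    and A_pd: "pd k (A i j) x = (if i = tau k then A k j x else 0) - (if k = i then sg k * A (tau k) j x else 0)
      + (if j = tau k then A i k x else 0) - (if k = j then sg k * A i (tau k) x else 0)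
      + sg k * r k x * ((if k = j then W i x else 0) + (if k = i then W j x else 0))"
begin

lemma A_diff: "A i j differentiable (at x)"
  by (rule smooth_differentiable[OF A_smooth])

lemma W_diff: "W i differentiable (at x)"
  by (rule smooth_differentiable[OF W_smooth])

lemma pdW_diff: "pd k (W i) differentiable (at x)"
  by (rule smooth_differentiable[OF smooth_pd[OF W_smooth]])

lemma top_not_nontop: "tau p \<noteq> p \<Longrightarrow> p \<noteq> tau k"
  using tau_idem by metis

lemma pd_rW: "pd k (\<lambda>x. r t x * W j x) x = (if k = tau t then r t x * W j x else 0) + r t x * pd k (W j) x"
  by (simp add: pd_mult diff_r W_diff pd_r)

lemma rW_diff: "(\<lambda>x. r t x * W j x) differentiable (at x)"
  by (intro differentiable_mult diff_r W_diff)

lemma pd_top: "tau t = t \<Longrightarrow> j \<noteq> t \<Longrightarrow> pd t (A t j) x = r t x * W j x"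
  by (simp add: A_pd sg_top')

lemma pd_top_top: "tau t = t \<Longrightarrow> pd t (A t t) x = 2 * r t x * W t x"
  by (simp add: A_pd sg_top')

lemma pd_top_nontop: "tau t = t \<Longrightarrow> i \<noteq> t \<Longrightarrow> j \<noteq> t \<Longrightarrow> pd t (A i j) x = 0"
  by (simp add: A_pd)

lemma pd_nontop_self:
  assumes "tau p \<noteq> p" "j \<noteq> p" "j \<noteq> tau p"
  shows "pd p (A p j) x = sg p * (r p x * W j x - A (tau p) j x)"
  using assms by (simp add: A_pd algebra_simps)

lemma pd_nontop_diag:
  assumes "tau p \<noteq> p"
  shows "pd p (A p p) x = 2 * (sg p * (r p x * W p x - A (tau p) p x))"
  using assms by (simp add: A_pd algebra_simps A_sym[of p "tau p"])

lemma pd_nontop_other: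
  assumes "tau p \<noteq> p" "i \<noteq> p" "j \<noteq> p" "i \<noteq> tau p" "j \<noteq> tau p"
  shows "pd p (A i j) x = 0"
  using assms by (simp add: A_pd)

lemma pd_nontop_top:
  assumes "tau p \<noteq> p" "j \<noteq> p" "j \<noteq> tau p"
  shows "pd p (A (tau p) j) x = A p j x"
  using assms by (simp add: A_pd)

text \<open>On \<open>A (tau q) j\<close> the partials along \<open>q\<close> and then
  \<open>tau q\<close> give 0, in the other order \<open>r q\<close> times
  \<open>pd q (W j)\<close>. So this derivative of \<open>W\<close> vanishes, and the last
  assumption turns that into a statement on \<open>A\<close>.\<close>

lemma A_zero_via_partner:
  assumes q: "tau q \<noteq> q" and j: "j \<noteq> q" "j \<noteq> tau q"
    and *: "\<And>x. A q j x = r q x * pd q (W j) x"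
  shows "A q j x = 0"
proof -
  let ?t = "tau q"
  have "pd q (A ?t j) = A q j" using pd_nontop_top[OF q j] by blast
  then have "pd ?t (pd q (A ?t j)) x = 0"
    using q j by (simp add: pd_top_nontop)
  moreover have "pd ?t (A ?t j) = (\<lambda>x. r ?t x * W j x)"
    using j by (auto simp: pd_top)
  then have "pd q (pd ?t (A ?t j)) x = r q x * pd q (W j) x"
    using q by (simp add: pd_rW)
  ultimately show ?thesis
    using * pd_commute[OF A_smooth] by metis
qed

text \<open>Mixed partials of \<open>A p p\<close> along \<open>p\<close> and \<open>q\<close>: the
  derivative along \<open>q\<close> is zero, while the one along \<open>p\<close> contains both
  \<open>W p\<close> and \<open>A (tau p) p\<close>. The second base direction is essential.\<close>

lemma W_pd_block:
  assumes "tau p \<noteq> p" "tau q \<noteq> q" "tau q = tau p" "p \<noteq> q"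
  shows "A q p x = r q x * pd q (W p) x"
proof -
  have "pd q (A p p) = (\<lambda>x. 0)"
    using assms by (intro ext pd_nontop_other) (auto simp: top_not_nontop)
  then have "pd p (pd q (A p p)) x = 0" by simp
  then have "pd q (pd p (A p p)) x = 0" by (simp add: pd_commute[OF A_smooth])
  moreover have "pd p (A p p) = (\<lambda>x. 2 * (sg p * (r p x * W p x - A (tau p) p x)))"
    using assms by (intro ext pd_nontop_diag)
  moreover have "r p = r q" using assms(3) by (simp add: r_def fun_eq_iff)
  moreover have "pd q (A (tau p) p) x = A q p x"
    using pd_nontop_top[of q p x] assms top_not_nontop by metis
  ultimately show ?thesis
    using assms by (simp add: pd_cmult pd_diff rW_diff A_diff differentiable_diff differentiable_mult pd_rW)
qed

text \<open>The same comparison for \<open>A p j\<close>, with \<open>p\<close> only an auxiliary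
  direction that drops out of the result.\<close>

lemma W_pd_outside:
  assumes "tau p \<noteq> p" "tau q \<noteq> q" "tau q = tau p" "p \<noteq> q" "tau j \<noteq> tau p"
  shows "A q j x = r q x * pd q (W j) x"
proof -
  have j: "j \<noteq> p" "j \<noteq> q" "j \<noteq> tau p" using assms by auto
  have "pd q (A p j) = (\<lambda>x. 0)"
    using assms j by (intro ext pd_nontop_other) (auto simp: top_not_nontop)
  then have "pd p (pd q (A p j)) x = 0" by simp
  then have "pd q (pd p (A p j)) x = 0" by (simp add: pd_commute[OF A_smooth])
  moreover have "pd p (A p j) = (\<lambda>x. sg p * (r p x * W j x - A (tau p) j x))"
    using assms j by (intro ext pd_nontop_self)
  moreover have "r p = r q" using assms(3) by (simp add: r_def fun_eq_iff)
  moreover have "pd q (A (tau p) j) x = A q j x"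
    using pd_nontop_top[of q j x] assms j by metis
  ultimately show ?thesis
    using assms by (simp add: pd_cmult pd_diff rW_diff A_diff differentiable_diff differentiable_mult pd_rW)
qed

lemma A_block_zero:
  assumes "tau p \<noteq> p" "tau q \<noteq> q" "tau q = tau p" "p \<noteq> q"
  shows "A q p x = 0"
  using assms by (intro A_zero_via_partner W_pd_block) (auto simp: top_not_nontop)

lemma A_outside_zero:
  assumes q: "tau q \<noteq> q" and j: "tau j \<noteq> tau q"
  shows "A q j x = 0"
proof -
  obtain p where "p \<noteq> q" "tau p \<noteq> p" "tau p = tau q"
    using two[OF q] by auto
  then show ?thesis
    using q j by (intro A_zero_via_partner W_pd_outside[of p]) auto
qed

text \<open>\<open>A p q\<close> vanishes identically for a partner \<open>p\<close>; its derivative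
  along \<open>p\<close> is, up to sign, the difference of the two sides.\<close>

lemma A_top_nontop:
  assumes q: "tau q \<noteq> q"
  shows "A (tau q) q x = r q x * W q x"
proof -
  obtain p where p: "p \<noteq> q" "tau p \<noteq> p" "tau p = tau q"
    using two[OF q] by auto
  have "A p q = (\<lambda>x. 0)"
    using p q by (intro ext A_block_zero) auto
  then have "pd p (A p q) x = 0" by simp
  moreover have "r p = r q" using p(3) by (simp add: r_def fun_eq_iff)
  ultimately show ?thesis
    using pd_nontop_self[of p q x] p q by (simp add: top_not_nontop)
qed

lemma A_top_outside:
  assumes q: "tau q \<noteq> q" and j: "tau j \<noteq> tau q"
  shows "A (tau q) j x = r q x * W j x"
proof -
  have "A q j = (\<lambda>x. 0)"
    using q j by (intro ext A_outside_zero)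
  then have "pd q (A q j) x = 0" by simp
  moreover have "j \<noteq> q" "j \<noteq> tau q" using j by auto
  ultimately show ?thesis
    using pd_nontop_self[of q j x] q by simp
qed

lemma pd_A_top_nontop:
  assumes p: "tau p \<noteq> p"
  shows "pd p (A (tau p) p) x = A p p x - sg p * (A (tau p) (tau p) x - r p x * W (tau p) x)"
  using p by (simp add: A_pd algebra_simps)

text \<open>Comes from the mixed partials of \<open>A (tau p) p\<close> along \<open>p\<close> and
  \<open>tau p\<close>.\<close>

lemma pd_W_diag:
  assumes p: "tau p \<noteq> p"
  shows "pd p (W p) x = sg p * (pd (tau p) (W (tau p)) x - W (tau p) x)"
proof -
  let ?t = "tau p"
  have "pd p (A ?t p) = (\<lambda>x. A p p x - sg p * (A ?t ?t x - r p x * W ?t x))"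
    using p by (intro ext pd_A_top_nontop)
  then have "pd ?t (pd p (A ?t p)) x = - sg p * (2 * r ?t x * W ?t x - pd ?t (\<lambda>x. r p x * W ?t x) x)"
    using p by (simp add: pd_cmult pd_diff rW_diff A_diff differentiable_diff differentiable_mult
        pd_top_nontop pd_top_top)
  also have "\<dots> = r p x * (sg p * (pd ?t (W ?t) x - W ?t x))"
    by (simp add: pd_rW algebra_simps)
  finally have 1: "pd ?t (pd p (A ?t p)) x = r p x * (sg p * (pd ?t (W ?t) x - W ?t x))" .
  have "pd ?t (A ?t p) = (\<lambda>x. r p x * W p x)"
    using p by (intro ext) (simp add: pd_top)
  then have "pd p (pd ?t (A ?t p)) x = r p x * pd p (W p) x"
    using p by (simp add: pd_rW)
  then have "r p x * pd p (W p) x = r p x * (sg p * (pd ?t (W ?t) x - W ?t x))"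
    using 1 pd_commute[OF A_smooth] by metis
  then show ?thesis by simp
qed

lemma pd_W_top:
  assumes q: "tau q \<noteq> q"
  shows "pd q (W (tau q)) x = W q x"
proof -
  let ?t = "tau q"
  have "pd q (A ?t ?t) = (\<lambda>x. 2 * A ?t q x)"
    using q by (auto simp: A_pd A_sym[of q ?t])
  then have "pd ?t (pd q (A ?t ?t)) x = 2 * (r q x * W q x)"
    using q by (simp add: pd_cmult A_diff pd_top)
  moreover have "pd ?t (A ?t ?t) = (\<lambda>x. 2 * (r q x * W ?t x))"
    by (auto simp: pd_top_top)
  then have "pd q (pd ?t (A ?t ?t)) x = 2 * (r q x * pd q (W ?t) x)"
    using q by (simp add: pd_cmult rW_diff pd_rW)
  ultimately have "2 * (r q x * pd q (W ?t) x) = 2 * (r q x * W q x)"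
    using pd_commute[OF A_smooth] by metis
  then show ?thesis by simp
qed

lemma pd_tau_W:
  assumes q: "tau q \<noteq> q"
  shows "pd (tau q) (W q) x = 0"
proof -
  have "A (tau q) q = (\<lambda>x. r q x * W q x)"
    using A_top_nontop[OF q] by blast
  then have "pd (tau q) (A (tau q) q) x = r q x * W q x + r q x * pd (tau q) (W q) x"
    by (simp add: pd_rW)
  moreover have "pd (tau q) (A (tau q) q) x = r q x * W q x"
    using pd_top[of "tau q" q x] q by simp
  ultimately show ?thesis by simp
qed

text \<open>For a partner \<open>p\<close>, \<open>pd q (W p) = 0\<close>; commuting this with
  \<open>pd p\<close> in \<open>pd_W_diag\<close> gives that the mixed derivative of
  \<open>W (tau q)\<close> along \<open>tau q\<close> and \<open>q\<close> equals
  \<open>W q\<close>. Taken in the other order it is the derivative of \<open>W q\<close> along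
  \<open>tau q\<close>, which is 0.\<close>

lemma W_nontop:
  assumes q: "tau q \<noteq> q"
  shows "W q x = 0"
proof -
  obtain p where p: "p \<noteq> q" "tau p \<noteq> p" "tau p = tau q"
    using two[OF q] by auto
  have "pd q (W p) = (\<lambda>x. 0)"
    using A_block_zero[OF p(2) q] W_pd_block[OF p(2) q] p by auto
  then have 0: "pd q (pd p (W p)) x = 0"
    using pd_commute[OF W_smooth, of q p p x] by simp
  have "pd p (W p) = (\<lambda>x. sg p * (pd (tau q) (W (tau q)) x - W (tau q) x))"
    using pd_W_diag[OF p(2)] p(3) by auto
  then have "pd q (pd (tau q) (W (tau q))) x = pd q (W (tau q)) x"
    using 0 by (simp add: pd_cmult pd_diff W_diff pdW_diff differentiable_diff)
  moreover have "pd q (W (tau q)) = W q"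
    using pd_W_top[OF q] by blast
  ultimately show ?thesis
    using pd_commute[OF W_smooth, of q "tau q" "tau q" x] pd_tau_W[OF q] by simp
qed

lemma A_nontop_diag:
  assumes p: "tau p \<noteq> p"
  shows "A p p x = sg p * (A (tau p) (tau p) x - r p x * W (tau p) x)"
proof -
  have "A (tau p) p = (\<lambda>x. 0)"
    using A_top_nontop[OF p] W_nontop[OF p] by auto
  then show ?thesis using pd_A_top_nontop[OF p] by simp
qed

lemma A_nontop_diag_const:
  assumes p: "tau p \<noteq> p"
  shows "A p p x = A p p y"
proof (rule pd_zero_const[OF A_diff])
  show "pd k (A p p) x = 0" for k x
  proof (cases "k = p")
    case True
    then show ?thesis using pd_nontop_diag[OF p] A_top_nontop[OF p] by simp
  next
    case False
    then show ?thesis using p by (simp add: A_pd top_not_nontop)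
  qed
qed

text \<open>Once the constant base values are zero, \<open>A b b = r b * W b\<close> on every cone
  and all hinges on \<open>W\<close>. One reference cone suffices: its radial component obeys a
  linear equation that fixes \<open>W\<close> there, symmetry between cones carries this to the
  others, and the components against lines fix the rest. What remains between lines is
  constant.\<close>

lemma A_eq_zero:
  assumes diag: "\<And>b. b \<in> tau ` {p. tau p \<noteq> p} \<Longrightarrow> \<exists>p. tau p \<noteq> p \<and> tau p = b \<and> A p p 0 = 0"
    and t0: "A (tau neg) (tau neg) 0 = 0"
    and t0f: "\<And>f. f \<notin> tau ` {p. tau p \<noteq> p} \<Longrightarrow> tau f = f \<Longrightarrow> A (tau neg) f 0 = 0"
    and ff: "\<And>e f. e \<notin> tau ` {p. tau p \<noteq> p} \<Longrightarrow> tau e = e \<Longrightarrow>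
      f \<notin> tau ` {p. tau p \<noteq> p} \<Longrightarrow> tau f = f \<Longrightarrow> A e f 0 = 0"
  shows "A i j x = 0"
proof -
  let ?T = "tau ` {p. tau p \<noteq> p}" and ?t = "tau neg"
  have T: "tau b = b" if "b \<in> ?T" for b using that by auto
  have Tr: "A b j x = r b x * W j x" if "b \<in> ?T" "tau j \<noteq> b" for b j x
    using that A_top_outside by auto
  have ATT: "A b b x = r b x * W b x" if b: "b \<in> ?T" for b x
  proof -
    obtain p where p: "tau p \<noteq> p" "tau p = b" "A p p 0 = 0" using diag[OF b] by blast
    then have "A p p x = 0" using A_nontop_diag_const[of p x 0] by simp
    then show ?thesis using A_nontop_diag[OF p(1), of x] p(2) r_tau[of p] by simp
  qed
  have Adiag: "A q q x = 0" if q: "tau q \<noteq> q" for q x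
    using A_nontop_diag[OF q, of x] ATT[of "tau q" x] q by simp
  have t: "?t \<in> ?T" using neg by blast
  have A_t_nt: "A b k x = 0" if "b = tau k" "k \<noteq> b" for b k x
    using A_top_nontop[of k x] W_nontop[of k x] that by simp
  have At0: "A ?t ?t x = 0" for x
  \<comment> \<open>The radial derivative of \<open>A ?t ?t\<close> is twice
    \<open>r * W ?t\<close>, hence twice the component itself.\<close>
  proof (rule pd_eigen_zero[where c = 2 and j = ?t, OF A_diff _ t0])
    show "pd k (A ?t ?t) x = (if k = ?t then 2 * A ?t ?t x else 0)" for k x
    proof (cases "k = ?t")
      case True
      then show ?thesis using ATT[OF t, of x] pd_top_top[of ?t x] by simp
    next
      case False
      have "A ?t k x = 0" "A k ?t x = 0" if "?t = tau k"
        using A_t_nt[OF that False] A_sym[of k ?t] by simp_all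
      then have "(if ?t = tau k then A ?t k x else 0) = 0" "(if ?t = tau k then A k ?t x else 0) = 0"
        by presburger+
      then show ?thesis
        unfolding A_pd using False by (simp only: if_not_P) simp
    qed
  qed
  have Wt0: "W ?t x = 0" for x
    using ATT[OF t, of x] At0[of x] by simp
  have WT: "W b x = 0" if b: "b \<in> ?T" for b x
  proof (cases "b = ?t")
    case False
    \<comment> \<open>One symmetric component computed from either cone: \<open>W b\<close> is
      proportional to \<open>W ?t\<close>.\<close>
    then have "A ?t b x = r ?t x * W b x" "A b ?t x = r b x * W ?t x"
      using Tr t b T[OF b] by auto
    then show ?thesis using Wt0[of x] A_sym[of b ?t] by simp
  qed (simp add: Wt0)
  have flat: "k = f" if "f \<notin> ?T" "f = tau k" for f k
    using that by (cases "tau k = k") auto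
  have At0F: "A ?t f x = 0" if f: "f \<notin> ?T" "tau f = f" for f x
  proof (rule pd_eigen_zero[where c = 1 and j = ?t, OF A_diff _ t0f[OF f]])
    have ft: "f \<noteq> ?t" using f t by auto
    show "pd k (A ?t f) x = (if k = ?t then 1 * A ?t f x else 0)" for k x
    proof (cases "k = ?t")
      case True
      then show ?thesis using Tr[OF t, of f x] pd_top[of ?t f x] f ft by simp
    next
      case k: False
      have "A k f x = 0" if "?t = tau k"
        using A_outside_zero[of k f x] that k f ft by metis
      moreover have "f = tau k \<longleftrightarrow> k = f" using flat f by auto
      ultimately show ?thesis
        using k f ft by (auto simp: A_pd sg_top' Wt0)
    qed
  qed
  have WF: "W f x = 0" if f: "f \<notin> ?T" "tau f = f" for f x
    using Tr[OF t, of f x] At0F[OF f, of x] f t by auto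
  have W0: "W j x = 0" for j x
    using WT WF W_nontop by (cases "tau j = j"; cases "j \<in> ?T") auto
  have AFF: "A e f x = 0" if e: "e \<notin> ?T" "tau e = e" and f: "f \<notin> ?T" "tau f = f" for e f x
  proof -
    have "A e f x = A e f 0"
    proof (rule pd_zero_const[OF A_diff])
      have "e = tau k \<longleftrightarrow> k = e" "f = tau k \<longleftrightarrow> k = f" for k using flat e f by auto
      then show "pd k (A e f) x = 0" for k x
        using e f by (simp add: A_pd sg_top' W0)
    qed
    then show ?thesis using ff[OF e f] by simp
  qed
  have Ant: "A i j x = 0" if i: "tau i \<noteq> i" for i j x
  proof (cases "tau j = tau i")
    case True
    consider "j = i" | "j = tau i" | "j \<noteq> i" "tau j \<noteq> j" using True by metis
    then show ?thesis
    proof cases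
      case 2
      have "A (tau i) i x = 0" using A_top_nontop[OF i, of x] W0 by simp
      then show ?thesis unfolding 2 by (subst A_sym)
    next
      case 3
      then show ?thesis using A_block_zero[of j i x] True[symmetric] i by blast
    qed (simp add: Adiag i)
  qed (simp add: A_outside_zero i)
  have AT: "A i j x = 0" if i: "i \<in> ?T" for i j x
  proof (cases "tau j = i")
    case True
    show ?thesis
    proof (cases "tau j = j")
      case True
      then show ?thesis using \<open>tau j = i\<close> ATT[OF i] W0 by simp
    next
      case False
      then show ?thesis by (subst A_sym) (rule Ant)
    qed
  qed (simp add: Tr i W0)
  show ?thesis
  proof (cases "tau i = i \<and> tau j = j \<and> i \<notin> ?T \<and> j \<notin> ?T")
    case True
    then show ?thesis using AFF by blast
  next
    case False
    then consider "tau i \<noteq> i \<or> i \<in> ?T" | "tau j \<noteq> j \<or> j \<in> ?T" by blast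
    then show ?thesis
    proof cases
      case 1
      then show ?thesis using Ant AT by blast
    next
      case 2
      then have "A j i x = 0" using Ant AT by blast
      then show ?thesis by (subst A_sym)
    qed
  qed
qed

end

subsection \<open>The degree of mobility\<close>

context cone_product
begin

definition iv :: "'n \<Rightarrow> real ^ 'n \<Rightarrow> real"
  where "iv i x = exp (- 1 * x $ tau i)"

lemma iv_r [simp]: "iv i x * r i x = 1"
  by (simp add: iv_def r_def exp_minus)

lemma iv_tau: "iv (tau i) = iv i"
  by (simp add: iv_def fun_eq_iff)

lemma iv_smooth: "smooth (iv i)"
  unfolding iv_def[abs_def] by (rule smooth_exp_coord)

lemma iv_diff: "iv i differentiable (at x)"
  by (rule smooth_differentiable[OF iv_smooth])

lemma pd_iv: "pd k (iv i) x = (if k = tau i then - iv i x else 0)"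
  unfolding iv_def[abs_def] pd_exp_coord by simp

text \<open>Components of a solution with respect to the frame \<open>\<partial>\<^sub>i / r\<^sub>i\<close>, which is
  pseudo-orthonormal.\<close>

lemma frame_solution_of_mobility:
  assumes a: "smooth_tensor2 a" "sym_tensor2 a" and w: "smooth_form w"
    and eq: "\<And>x i j k. cov_deriv g a x i j k = w x $ i * g x $ j $ k + w x $ j * g x $ i $ k"
  shows "frame_solution tau neg (\<lambda>i j x. a x $ i $ j * (iv i x * iv j x)) (\<lambda>i x. w x $ i * iv i x)"
proof unfold_locales
  have a_sm: "smooth (\<lambda>x. a x $ i $ j)" for i j
    using a(1) by (simp add: smooth_tensor2_def)
  have a_diff: "(\<lambda>x. a x $ i $ j) differentiable (at x)" for i j x
    by (rule smooth_differentiable[OF a_sm])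
  have w_sm: "smooth (\<lambda>x. w x $ i)" for i
    using w by (simp add: smooth_form_def)
  show "smooth (\<lambda>x. a x $ i $ j * (iv i x * iv j x))" for i j
    by (intro smooth_mult a_sm iv_smooth)
  show "smooth (\<lambda>x. w x $ i * iv i x)" for i
    by (intro smooth_mult w_sm iv_smooth)
  have a_sym: "a x $ i $ j = a x $ j $ i" for x i j
    using a(2) unfolding sym_tensor2_def transpose_def by (metis vec_lambda_beta)
  then show "(\<lambda>x. a x $ i $ j * (iv i x * iv j x)) = (\<lambda>x. a x $ j $ i * (iv j x * iv i x))" for i j
    by (simp add: fun_eq_iff mult.commute)
  fix i j k x
  have pda: "pd k (\<lambda>y. a y $ i $ j) x =
    ((if i = tau k then a x $ k $ j else 0) + (if k = tau i then a x $ i $ j else 0)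
      - (if k = i then sg k * a x $ tau k $ j else 0))
    + ((if j = tau k then a x $ i $ k else 0) + (if k = tau j then a x $ i $ j else 0)
      - (if k = j then sg k * a x $ i $ tau k else 0))
    + (if k = j then w x $ i * (sg k * (r k x * r k x)) else 0)
    + (if k = i then w x $ j * (sg k * (r k x * r k x)) else 0)"
  proof -
    have "w x $ i * g x $ j $ k = (if k = j then w x $ i * (sg k * (r k x * r k x)) else 0)"
      "w x $ j * g x $ i $ k = (if k = i then w x $ j * (sg k * (r k x * r k x)) else 0)"
      by (auto simp: g_def)
    then show ?thesis
      using eq[of x i j k] unfolding cov_deriv_def christoffel_g gam_sum by linarith
  qed
  \<comment> \<open>The subtracted terms, from differentiating \<open>iv\<close>, cancel the terms
    of \<open>pda\<close> with \<open>k = tau i\<close> and \<open>k = tau j\<close>.\<close>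
  have pdA: "pd k (\<lambda>x. a x $ i $ j * (iv i x * iv j x)) x = pd k (\<lambda>y. a y $ i $ j) x * (iv i x * iv j x)
      - (if k = tau i then a x $ i $ j * (iv i x * iv j x) else 0)
      - (if k = tau j then a x $ i $ j * (iv i x * iv j x) else 0)"
    by (simp add: pd_mult a_diff iv_diff differentiable_mult pd_iv algebra_simps)
  have 1: "(if i = tau k then a x $ k $ j else 0) * (iv i x * iv j x)
      = (if i = tau k then a x $ k $ j * (iv k x * iv j x) else 0)"
    "(if j = tau k then a x $ i $ k else 0) * (iv i x * iv j x)
      = (if j = tau k then a x $ i $ k * (iv i x * iv k x) else 0)"
    "(if k = i then sg k * a x $ tau k $ j else 0) * (iv i x * iv j x)
      = (if k = i then sg k * (a x $ tau k $ j * (iv (tau k) x * iv j x)) else 0)"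
    "(if k = j then sg k * a x $ i $ tau k else 0) * (iv i x * iv j x)
      = (if k = j then sg k * (a x $ i $ tau k * (iv i x * iv (tau k) x)) else 0)"
    by (simp_all add: iv_tau)
  have 2: "(if k = j then w x $ i * (sg k * (r k x * r k x)) else 0) * (iv i x * iv j x)
      = sg k * r k x * (if k = j then w x $ i * iv i x else 0)"
  proof (cases "k = j")
    case True
    have "w x $ i * (sg j * (r j x * r j x)) * (iv i x * iv j x)
      = sg j * r j x * (w x $ i * iv i x) * (iv j x * r j x)" by (simp only: ac_simps)
    then show ?thesis using True by simp
  qed simp
  have 3: "(if k = i then w x $ j * (sg k * (r k x * r k x)) else 0) * (iv i x * iv j x)
      = sg k * r k x * (if k = i then w x $ j * iv j x else 0)"
  proof (cases "k = i")
    case True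
    have "w x $ j * (sg i * (r i x * r i x)) * (iv i x * iv j x)
      = sg i * r i x * (w x $ j * iv j x) * (iv i x * r i x)" by (simp only: ac_simps)
    then show ?thesis using True by simp
  qed simp
  have 4: "(if k = tau i then a x $ i $ j else 0) * (iv i x * iv j x)
      = (if k = tau i then a x $ i $ j * (iv i x * iv j x) else 0)"
    "(if k = tau j then a x $ i $ j else 0) * (iv i x * iv j x)
      = (if k = tau j then a x $ i $ j * (iv i x * iv j x) else 0)"
    by simp_all
  show "pd k (\<lambda>x. a x $ i $ j * (iv i x * iv j x)) x =
      (if i = tau k then a x $ k $ j * (iv k x * iv j x) else 0)
      - (if k = i then sg k * (a x $ tau k $ j * (iv (tau k) x * iv j x)) else 0)
      + (if j = tau k then a x $ i $ k * (iv i x * iv k x) else 0)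
      - (if k = j then sg k * (a x $ i $ tau k * (iv i x * iv (tau k) x)) else 0)
      + sg k * r k x * ((if k = j then w x $ i * iv i x else 0) + (if k = i then w x $ j * iv j x else 0))"
    unfolding pdA pda distrib_right left_diff_distrib distrib_left 1 2 3 4 by simp
qed

section \<open>The explicit solutions\<close>

definition tops :: "'n set"
  where "tops = tau ` {p. tau p \<noteq> p}"

definition flats :: "'n set"
  where "flats = {i. tau i = i} - tops"

text \<open>Labels for the forms whose products are used: a line stands for its own parallel form,
  and \<open>tau neg\<close>, the top of the reference cone, for the single homothetic one.\<close>

definition basis_idx :: "'n set"
  where "basis_idx = insert (tau neg) flats"

definition leaf :: "'n \<Rightarrow> 'n"
  where "leaf b = (SOME p. tau p \<noteq> p \<and> tau p = b)"

lemma leaf: "b \<in> tops \<Longrightarrow> tau (leaf b) \<noteq> leaf b" "b \<in> tops \<Longrightarrow> tau (leaf b) = b"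
proof -
  have "tau (leaf b) \<noteq> leaf b \<and> tau (leaf b) = b" if "b \<in> tops"
  proof -
    have "\<exists>p. tau p \<noteq> p \<and> tau p = b" using that unfolding tops_def by blast
    then show ?thesis unfolding leaf_def by (rule someI_ex)
  qed
  then show "b \<in> tops \<Longrightarrow> tau (leaf b) \<noteq> leaf b" "b \<in> tops \<Longrightarrow> tau (leaf b) = b"
    by blast+
qed

lemma neg_tops: "tau neg \<in> tops"
  using neg unfolding tops_def by blast

lemma flats_iff: "f \<in> flats \<longleftrightarrow> tau f = f \<and> (\<forall>k. tau k = f \<longrightarrow> k = f)"
proof (cases "tau f = f")
  case True
  have "f \<in> tops \<longleftrightarrow> (\<exists>k. tau k = f \<and> k \<noteq> f)"
    unfolding tops_def using True by force
  then show ?thesis using True by (auto simp: flats_def)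
qed (simp add: flats_def)

lemma neg_not_flat: "tau neg \<notin> flats"
  using neg_tops by (simp add: flats_def)

lemma basis_idx_tau: "u \<in> basis_idx \<Longrightarrow> tau u = u"
  by (auto simp: basis_idx_def flats_def)

text \<open>For \<open>u \<in> flats\<close> the form \<open>theta u\<close> is the parallel form \<open>dr\<^sub>u\<close>; the form for
  \<open>u = tau neg\<close> is the dual of the homothetic field minus all \<open>dr\<^sub>f\<close>, a combination chosen so that
  the frame components at the origin form a unit matrix.\<close>

definition theta :: "'n \<Rightarrow> real ^ 'n \<Rightarrow> 'n \<Rightarrow> real"
  where "theta u x i = (if u = tau neg then xi x i - (if i \<in> flats then r i x else 0)
    else if i = u then r i x else 0)"

text \<open>The factor in nabla theta = kappa g: 0 for a parallel form, 1 for the homothetic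
  one.\<close>

definition kappa :: "'n \<Rightarrow> real"
  where "kappa u = (if u = tau neg then 1 else 0)"

text \<open>The form dr = r dx of a line is parallel: its coordinate derivative stands on the left,
  the connection terms on the right.\<close>

lemma cov_dr_flat:
  assumes f: "f \<in> flats"
  shows "(if k = i then (if i = f then r i x else 0) else 0)
    = (\<Sum>m\<in>UNIV. gam m k i * (if m = f then r m x else 0))"
proof -
  have "(if k = tau i then (if i = f then r i x else 0) else 0) = (if k = i then (if i = f then r i x else 0) else 0)"
    "(if i = tau k then (if k = f then r k x else 0) else 0) = (if k = i then (if i = f then r i x else 0) else 0)"
    "(if tau k = f then r (tau k) x else 0) = (if k = f then r k x else 0)"
    using f by (auto simp: flats_iff)
  moreover have "sg f = 1" using f by (simp add: flats_iff sg_top')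
  ultimately show ?thesis unfolding gam_sum by auto
qed

lemma cov_dr_flats:
  "(if k = i then (if i \<in> flats then r i x else 0) else 0)
    = (\<Sum>m\<in>UNIV. gam m k i * (if m \<in> flats then r m x else 0))"
proof -
  have "(\<Sum>m\<in>UNIV. gam m k i * (if m \<in> flats then r m x else 0))
    = (\<Sum>m\<in>UNIV. \<Sum>f\<in>flats. gam m k i * (if m = f then r m x else 0))"
    by (rule sum.cong) (simp_all add: sum_distrib_left[symmetric])
  also have "\<dots> = (\<Sum>f\<in>flats. if k = i then (if i = f then r i x else 0) else 0)"
    by (subst sum.swap) (simp add: cov_dr_flat)
  finally show ?thesis by simp
qed

lemma theta_smooth: "smooth (\<lambda>x. theta u x i)"
  unfolding theta_def
  by (cases "u = tau neg"; cases "i \<in> flats"; cases "i = u")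
    (auto intro!: smooth_diff xi_smooth smooth_r)

lemma theta_diff: "(\<lambda>x. theta u x i) differentiable (at x)"
  by (rule smooth_differentiable[OF theta_smooth])

lemma cov_theta:
  assumes u: "u \<in> basis_idx"
  shows "pd k (\<lambda>x. theta u x i) x = kappa u * g x $ i $ k + (\<Sum>m\<in>UNIV. gam m k i * theta u x m)"
proof (cases "u = tau neg")
  case True
  have d: "(\<lambda>x. if i \<in> flats then r i x else 0) differentiable (at x)"
    by (cases "i \<in> flats") (simp_all add: diff_r)
  have "pd k (\<lambda>x. if i \<in> flats then r i x else 0) x = (if k = i then (if i \<in> flats then r i x else 0) else 0)"
    using flats_iff[of i] by (cases "i \<in> flats") (simp_all add: pd_r)
  then have "pd k (\<lambda>x. theta u x i) x = g x $ i $ k + (\<Sum>m\<in>UNIV. gam m k i * xi x m)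
      - (\<Sum>m\<in>UNIV. gam m k i * (if m \<in> flats then r m x else 0))"
    unfolding theta_def using True d by (simp add: pd_diff xi_diff cov_xi cov_dr_flats)
  then show ?thesis
    using True by (simp add: theta_def kappa_def right_diff_distrib sum_subtractf)
next
  case False
  then have f: "u \<in> flats" using u by (simp add: basis_idx_def)
  have "pd k (\<lambda>x. if i = u then r i x else 0) x = (if k = i then (if i = u then r i x else 0) else 0)"
    using f flats_iff[of u] by (cases "i = u") (simp_all add: pd_r)
  then show ?thesis
    using False f unfolding theta_def by (simp add: kappa_def cov_dr_flat)
qed

lemma theta_at_0:
  assumes "u \<in> basis_idx" "i \<in> basis_idx"
  shows "theta u 0 i = (if u = i then 1 else 0)"
  using assms neg_not_flat flats_iff by (auto simp: theta_def basis_idx_def xi_def r_def)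

lemma theta_nontop:
  assumes "u \<in> basis_idx" "tau p \<noteq> p"
  shows "theta u x p = 0"
  using assms basis_idx_tau[of u] by (auto simp: theta_def xi_def flats_iff)

text \<open>The orderings of an unordered pair, so that summing over them symmetrizes. A singleton
  has one ordering, which gives squares and mixed products alike the entry 1 at the origin.\<close>

definition pairs :: "'n set \<Rightarrow> ('n \<times> 'n) set"
  where "pairs S = {(u, v). u \<in> basis_idx \<and> v \<in> basis_idx \<and> {u, v} = S}"

definition E :: "'n set \<Rightarrow> 'n tensor2"
  where "E S x = (\<chi> i j. \<Sum>(u, v)\<in>pairs S. theta u x i * theta v x j)"

definition G :: "'n \<Rightarrow> 'n tensor2"
  where "G b x = (\<chi> i j. if tau i = b then g x $ i $ j else 0)"

lemma pairs_swap: "(\<Sum>(u, v)\<in>pairs S. F v u) = (\<Sum>(u, v)\<in>pairs S. F u v)"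
  by (rule sum.reindex_bij_witness[where i = prod.swap and j = prod.swap])
    (auto simp: pairs_def insert_commute)

lemma E_mobility: "E S \<in> mobility_space g"
proof -
  \<comment> \<open>Each factor contributes its derivative kappa g times the other factor; swapping
    the pair merges the two halves into this one form.\<close>
  define w where "w x = (\<chi> i. \<Sum>(u, v)\<in>pairs S. kappa v * theta u x i)" for x
  have sm: "smooth_tensor2 (E S)"
    unfolding smooth_tensor2_def E_def
    by (auto simp: case_prod_beta intro!: smooth_sum smooth_mult theta_smooth)
  have sw: "smooth_form w"
    unfolding smooth_form_def w_def
    by (auto simp: case_prod_beta intro!: smooth_sum smooth_mult theta_smooth)
  have sy: "sym_tensor2 (E S)"
    unfolding sym_tensor2_def transpose_def E_def vec_eq_iff
    using pairs_swap[of "\<lambda>u v. theta v x j * theta u x i" for x i j S]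
    by (auto simp: mult.commute pairs_swap[of "\<lambda>u v. theta u x i * theta v x j" S for x i j])
  have "cov_deriv g (E S) x i j k = w x $ i * g x $ j $ k + w x $ j * g x $ i $ k" for x i j k
  proof -
    have X: "(\<Sum>m\<in>UNIV. gam m k i * E S x $ m $ j)
        = (\<Sum>(u, v)\<in>pairs S. (\<Sum>m\<in>UNIV. gam m k i * theta u x m) * theta v x j)"
      by (simp add: E_def sum_distrib_left sum_distrib_right case_prod_beta mult.assoc)
        (rule sum.swap)
    have Y: "(\<Sum>m\<in>UNIV. gam m k j * E S x $ i $ m)
        = (\<Sum>(u, v)\<in>pairs S. theta u x i * (\<Sum>m\<in>UNIV. gam m k j * theta v x m))"
      by (simp add: E_def sum_distrib_left sum_distrib_right case_prod_beta mult.left_commute)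
        (rule sum.swap)
    have "pd k (\<lambda>x. E S x $ i $ j) x = (\<Sum>z\<in>pairs S. pd k (\<lambda>x. theta (fst z) x i * theta (snd z) x j) x)"
      unfolding E_def case_prod_beta vec_lambda_beta
      by (rule pd_sum) (intro differentiable_mult theta_diff)
    also have "\<dots> = (\<Sum>(u, v)\<in>pairs S.
        (kappa u * g x $ i $ k + (\<Sum>m\<in>UNIV. gam m k i * theta u x m)) * theta v x j
        + theta u x i * (kappa v * g x $ j $ k + (\<Sum>m\<in>UNIV. gam m k j * theta v x m)))"
      by (rule sum.cong) (auto simp: pd_mult theta_diff cov_theta pairs_def)
    also have "\<dots> = (\<Sum>(u, v)\<in>pairs S. kappa u * theta v x j * g x $ i $ k)
        + (\<Sum>(u, v)\<in>pairs S. kappa v * theta u x i * g x $ j $ k)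
        + (\<Sum>(u, v)\<in>pairs S. (\<Sum>m\<in>UNIV. gam m k i * theta u x m) * theta v x j)
        + (\<Sum>(u, v)\<in>pairs S. theta u x i * (\<Sum>m\<in>UNIV. gam m k j * theta v x m))"
      unfolding sum.distrib[symmetric] case_prod_beta
      by (rule sum.cong) (simp_all add: distrib_left distrib_right ac_simps)
    finally have "cov_deriv g (E S) x i j k
        = (\<Sum>(u, v)\<in>pairs S. kappa u * theta v x j * g x $ i $ k)
          + (\<Sum>(u, v)\<in>pairs S. kappa v * theta u x i * g x $ j $ k)"
      unfolding cov_deriv_def christoffel_g X Y by simp
    also have "(\<Sum>(u, v)\<in>pairs S. kappa u * theta v x j * g x $ i $ k)
        = (\<Sum>(u, v)\<in>pairs S. kappa v * theta u x j * g x $ i $ k)"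
      by (rule pairs_swap[of "\<lambda>u v. kappa v * theta u x j * g x $ i $ k"])
    finally show ?thesis
      by (simp add: w_def sum_distrib_right case_prod_beta)
  qed
  then show ?thesis
    using sm sw sy unfolding mobility_space_def by blast
qed

lemma G_mobility: "G b \<in> mobility_space g"
proof -
  have sm: "smooth_tensor2 (G b)"
    unfolding smooth_tensor2_def G_def
  proof (intro allI)
    show "smooth (\<lambda>x. (\<chi> i j. if tau i = b then g x $ i $ j else 0) $ i $ j)" for i j
      by (cases "tau i = b") (simp_all add: g_smooth)
  qed
  have sy: "sym_tensor2 (G b)"
    by (auto simp: sym_tensor2_def transpose_def G_def vec_eq_iff g_def)
  have "cov_deriv g (G b) x i j k = 0" for x i j k
  proof -
    have g0: "g x $ p $ q = 0" if "tau p \<noteq> tau q" for p q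
      using that by (auto simp: g_def)
    \<comment> \<open>The connection does not mix factors, so restricting \<open>g\<close> to one of
      them commutes with covariant differentiation and the 1-form is 0.\<close>
    have gam0: "gam m p q = 0 \<or> tau q = tau m" for m p q
      by (auto simp: gam_def)
    have "(\<Sum>m\<in>UNIV. gam m k i * G b x $ m $ j)
        = (if tau i = b then (\<Sum>m\<in>UNIV. gam m k i * g x $ m $ j) else 0)"
      by (cases "tau i = b") (auto simp: G_def intro!: sum.cong sum.neutral, (metis gam0)+)
    moreover have "(\<Sum>m\<in>UNIV. gam m k j * G b x $ i $ m)
        = (if tau i = b then (\<Sum>m\<in>UNIV. gam m k j * g x $ i $ m) else 0)"
      by (simp add: G_def)
    moreover have "pd k (\<lambda>y. G b y $ i $ j) x = (if tau i = b then pd k (\<lambda>y. g y $ i $ j) x else 0)"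
      by (simp add: G_def)
    ultimately show ?thesis
      unfolding cov_deriv_def christoffel_g by (simp add: g_compat)
  qed
  moreover have "smooth_form (\<lambda>x. 0)"
    by (simp add: smooth_form_def)
  ultimately show ?thesis
    using sm sy unfolding mobility_space_def
    by (auto intro!: exI[of _ "\<lambda>x. 0"])
qed

lemma cov_deriv_add:
  assumes "smooth_tensor2 a" "smooth_tensor2 b"
  shows "cov_deriv g (a + b) x i j k = cov_deriv g a x i j k + cov_deriv g b x i j k"
proof -
  have "(\<lambda>x. a x $ i $ j) differentiable (at x)" "(\<lambda>x. b x $ i $ j) differentiable (at x)"
    using assms by (auto simp: smooth_tensor2_def intro: smooth_differentiable)
  then show ?thesis
    by (simp add: cov_deriv_def pd_add distrib_left sum.distrib)
qed

lemma cov_deriv_scale: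
  assumes "smooth_tensor2 a"
  shows "cov_deriv g (scale_tensor2 c a) x i j k = c * cov_deriv g a x i j k"
proof -
  have "(\<lambda>x. a x $ i $ j) differentiable (at x)"
    using assms by (auto simp: smooth_tensor2_def intro: smooth_differentiable)
  then show ?thesis
    by (simp add: cov_deriv_def scale_tensor2_def pd_cmult right_diff_distrib sum_distrib_left
        mult.left_commute)
qed

lemma subspace_mobility: "tensor2.subspace (mobility_space g)"
proof (rule tensor2.subspaceI)
  have G0: "(\<lambda>x. 0) \<in> mobility_space g"
    unfolding mobility_space_def smooth_tensor2_def sym_tensor2_def cov_deriv_def
    by (auto simp: transpose_def vec_eq_iff smooth_form_def intro!: exI[of _ "\<lambda>x. 0"])
  then show "0 \<in> mobility_space g" by (simp add: zero_fun_def)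
next
  fix a b assume "a \<in> mobility_space g" "b \<in> mobility_space g"
  then obtain v w where a: "smooth_tensor2 a" "sym_tensor2 a" "smooth_form v"
      "\<And>x i j k. cov_deriv g a x i j k = v x $ i * g x $ j $ k + v x $ j * g x $ i $ k"
    and b: "smooth_tensor2 b" "sym_tensor2 b" "smooth_form w"
      "\<And>x i j k. cov_deriv g b x i j k = w x $ i * g x $ j $ k + w x $ j * g x $ i $ k"
    unfolding mobility_space_def by blast
  have "smooth_tensor2 (a + b)" "sym_tensor2 (a + b)" "smooth_form (v + w)"
    using a b by (auto simp: smooth_tensor2_def sym_tensor2_def smooth_form_def transpose_def
        vec_eq_iff intro: smooth_add)
  moreover have "cov_deriv g (a + b) x i j k = (v + w) x $ i * g x $ j $ k + (v + w) x $ j * g x $ i $ k"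
    for x i j k
    using a b by (simp add: cov_deriv_add algebra_simps)
  ultimately show "a + b \<in> mobility_space g"
    unfolding mobility_space_def by blast
next
  fix c a assume "a \<in> mobility_space g"
  then obtain v where a: "smooth_tensor2 a" "sym_tensor2 a" "smooth_form v"
      "\<And>x i j k. cov_deriv g a x i j k = v x $ i * g x $ j $ k + v x $ j * g x $ i $ k"
    unfolding mobility_space_def by blast
  have "smooth_tensor2 (scale_tensor2 c a)" "sym_tensor2 (scale_tensor2 c a)"
      "smooth_form (\<lambda>x. c *\<^sub>R v x)"
    using a by (auto simp: smooth_tensor2_def sym_tensor2_def smooth_form_def transpose_def
        vec_eq_iff scale_tensor2_def intro!: smooth_mult)
  moreover have "cov_deriv g (scale_tensor2 c a) x i j k
      = (c *\<^sub>R v x) $ i * g x $ j $ k + (c *\<^sub>R v x) $ j * g x $ i $ k" for x i j k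
    using a by (simp add: cov_deriv_scale algebra_simps)
  ultimately show "scale_tensor2 c a \<in> mobility_space g"
    unfolding mobility_space_def by blast
qed

section \<open>Dual functionals and the count\<close>

definition pick :: "'n set \<Rightarrow> 'n \<times> 'n"
  where "pick S = (SOME z. z \<in> pairs S)"

text \<open>Evaluation at the origin, where all radii are 1. \<open>G (tau neg)\<close> also has
  entry 1 at the place read off for \<open>{tau neg}\<close>; the base value of that cone is
  subtracted to compensate. The other tops lie outside \<open>basis_idx\<close>. The factor
  \<open>sg (leaf b)\<close> normalizes the base entry of \<open>g\<close> to 1.\<close>

definition coord :: "'n set + 'n \<Rightarrow> 'n tensor2 \<Rightarrow> real"
  where "coord z a = (case z of
      Inl S \<Rightarrow> a 0 $ fst (pick S) $ snd (pick S)
        - (if S = {tau neg} then sg (leaf (tau neg)) * a 0 $ leaf (tau neg) $ leaf (tau neg) else 0)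
    | Inr b \<Rightarrow> sg (leaf b) * a 0 $ leaf b $ leaf b)"

definition basis :: "'n set + 'n \<Rightarrow> 'n tensor2"
  where "basis z = (case z of Inl S \<Rightarrow> E S | Inr b \<Rightarrow> G b)"

text \<open>Only cones contribute a restriction of \<open>g\<close>: for a line \<open>f\<close>,
  \<open>G f\<close> is already \<open>E {f}\<close>.\<close>

definition index :: "('n set + 'n) set"
  where "index = {S. S \<subseteq> basis_idx \<and> (card S = 1 \<or> card S = 2)} <+> tops"

lemma pick_pairs:
  assumes "S \<subseteq> basis_idx" "card S = 1 \<or> card S = 2"
  shows "pick S \<in> pairs S"
proof -
  have "\<exists>u v. S = {u, v}"
    using assms(2) by (metis card_1_singletonE card_2_iff insert_absorb2)
  then have "\<exists>z. z \<in> pairs S"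
    using assms(1) by (auto simp: pairs_def)
  then show ?thesis unfolding pick_def by (rule someI_ex)
qed

lemma G_at_0_leaf: "b \<in> tops \<Longrightarrow> sg (leaf b) * G c 0 $ leaf b $ leaf b = (if b = c then 1 else 0)"
  by (simp add: G_def leaf g_def r_def)

lemma E_leaf:
  assumes "tau p \<noteq> p"
  shows "E S x $ p $ p = 0"
  unfolding E_def vec_lambda_beta
  by (rule sum.neutral) (auto simp: pairs_def theta_nontop assms)

lemma E_at_0:
  assumes "i \<in> basis_idx" "j \<in> basis_idx"
  shows "E S 0 $ i $ j = (if {i, j} = S then 1 else 0)"
proof -
  have "E S 0 $ i $ j = (\<Sum>z\<in>pairs S. if z = (i, j) then 1 else 0)"
    unfolding E_def vec_lambda_beta
    by (rule sum.cong) (auto simp: pairs_def theta_at_0 assms split: if_splits)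
  then show ?thesis
    using assms by (simp add: pairs_def)
qed

lemma coord_basis:
  assumes "y \<in> index" "z \<in> index"
  shows "coord y (basis z) = (if y = z then 1 else 0)"
proof (cases y)
  case y: (Inl S)
  then have S: "S \<subseteq> basis_idx" "card S = 1 \<or> card S = 2" using assms(1) by (auto simp: index_def)
  obtain i j where ij: "pick S = (i, j)" "i \<in> basis_idx" "j \<in> basis_idx" "{i, j} = S"
    using pick_pairs[OF S] by (auto simp: pairs_def)
  show ?thesis
  proof (cases z)
    case (Inl S')
    then show ?thesis
      using y ij E_leaf[OF leaf(1)[OF neg_tops]] by (simp add: coord_def basis_def E_at_0)
  next
    case (Inr b)
    then have b: "b \<in> tops" using assms(2) by (auto simp: index_def)
    have "G b 0 $ i $ j = (if S = {tau neg} \<and> tau neg = b then 1 else 0)"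
    proof (cases "i = j \<and> i = b")
      case True
      then have "b = tau neg" using ij(2) b by (auto simp: basis_idx_def flats_def)
      then show ?thesis using True ij(4) by (auto simp: G_def g_def r_def)
    next
      case False
      then have "G b 0 $ i $ j = 0" using basis_idx_tau[OF ij(2)] by (auto simp: G_def g_def)
      moreover have "\<not> (S = {tau neg} \<and> tau neg = b)" using False ij(4) by auto
      ultimately show ?thesis by simp
    qed
    then show ?thesis
      using y Inr ij(1) G_at_0_leaf[OF neg_tops, of b] by (simp add: coord_def basis_def)
  qed
next
  case y: (Inr b)
  then have b: "b \<in> tops" using assms(1) by (auto simp: index_def)
  show ?thesis
    using y G_at_0_leaf[OF b] E_leaf[OF leaf(1)[OF b]] by (cases z) (simp_all add: coord_def basis_def)
qed

lemma mobility_zero: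
  assumes a: "a \<in> mobility_space g" and 0: "\<And>z. z \<in> index \<Longrightarrow> coord z a = 0"
  shows "a = 0"
proof -
  obtain w where w: "smooth_tensor2 a" "sym_tensor2 a" "smooth_form w"
      "\<And>x i j k. cov_deriv g a x i j k = w x $ i * g x $ j $ k + w x $ j * g x $ i $ k"
    using a unfolding mobility_space_def by blast
  interpret frame_solution tau neg "\<lambda>i j x. a x $ i $ j * (iv i x * iv j x)" "\<lambda>i x. w x $ i * iv i x"
    by (rule frame_solution_of_mobility[OF w])
  have leaf0: "a 0 $ leaf b $ leaf b = 0" if "b \<in> tops" for b
  proof -
    have "Inr b \<in> index" unfolding index_def using that by (rule InrI)
    from 0[OF this] show ?thesis by (simp add: coord_def)
  qed
  have sym: "a x $ i $ j = a x $ j $ i" for x i j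
    using w(2) unfolding sym_tensor2_def transpose_def by (metis vec_lambda_beta)
  have idx0: "a 0 $ i $ j = 0" if ij: "i \<in> basis_idx" "j \<in> basis_idx" for i j
  proof -
    let ?S = "{i, j}"
    have S: "?S \<subseteq> basis_idx" "card ?S = 1 \<or> card ?S = 2" using ij by (auto simp: card_insert_if)
    then have "Inl ?S \<in> index" unfolding index_def by (intro InlI) blast
    from 0[OF this] have "a 0 $ fst (pick ?S) $ snd (pick ?S) = 0"
      using leaf0[OF neg_tops] by (simp add: coord_def)
    moreover have "pick ?S = (i, j) \<or> pick ?S = (j, i)"
      using pick_pairs[OF S] by (auto simp: pairs_def doubleton_eq_iff)
    ultimately show ?thesis using sym by auto
  qed
  have "a x $ i $ j * (iv i x * iv j x) = 0" for i j x
  proof (rule A_eq_zero)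
    show "\<exists>p. tau p \<noteq> p \<and> tau p = b \<and> a 0 $ p $ p * (iv p 0 * iv p 0) = 0"
      if "b \<in> tau ` {p. tau p \<noteq> p}" for b
      using that leaf leaf0 unfolding tops_def[symmetric] by (intro exI[of _ "leaf b"]) auto
  qed (use idx0 in \<open>auto simp: basis_idx_def flats_def tops_def\<close>)
  moreover have "iv i x \<noteq> 0" for i x by (simp add: iv_def)
  ultimately show ?thesis by (simp add: fun_eq_iff vec_eq_iff)
qed

lemma card_index: "card index = (card flats + 1) * (card flats + 2) div 2 + card tops"
proof -
  have fin: "finite basis_idx" by simp
  have cU: "card basis_idx = card flats + 1"
    using neg_not_flat by (simp add: basis_idx_def)
  have "{S. S \<subseteq> basis_idx \<and> (card S = 1 \<or> card S = 2)}
      = {S. S \<subseteq> basis_idx \<and> card S = 1} \<union> {S. S \<subseteq> basis_idx \<and> card S = 2}" by auto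
  then have "card {S. S \<subseteq> basis_idx \<and> (card S = 1 \<or> card S = 2)}
      = (card basis_idx choose 1) + (card basis_idx choose 2)"
    using n_subsets[OF fin] by (simp add: card_Un_disjoint disjoint_iff)
  also have "\<dots> = (card flats + 1) * (card flats + 2) div 2"
    unfolding cU choose_two by (simp add: algebra_simps)
  finally show ?thesis
    unfolding index_def by (simp add: card_Plus)
qed

lemma degree_of_mobility_g:
  "degree_of_mobility g = (card flats + 1) * (card flats + 2) div 2 + card tops"
proof -
  have "tensor2.dim (mobility_space g) = card index"
  proof (rule tensor2.dim_eq_card_dual_family[where b = basis and f = coord])
    show "basis z \<in> mobility_space g" for z
      by (cases z) (simp_all add: basis_def E_mobility G_mobility)
    show "coord z (a + b) = coord z a + coord z b" for z a b
      by (cases z) (simp_all add: coord_def algebra_simps)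
    show "coord z (scale_tensor2 c a) = c * coord z a" for z c a
      by (cases z) (simp_all add: coord_def scale_tensor2_def algebra_simps)
  qed (auto simp: subspace_mobility coord_basis intro: mobility_zero)
  then show ?thesis
    by (simp add: degree_of_mobility_def card_index)
qed

end

section \<open>Distributing the coordinates over cones and lines\<close>

lemma cone_product_exists:
  assumes n: "CARD('n::finite) = n" and L: "L \<ge> 1" and mL: "m + 3 * L \<le> n"
  obtains tau :: "'n::finite \<Rightarrow> 'n" and neg where "cone_product tau neg"
    "card {i. tau i = i \<and> (\<forall>k. tau k = i \<longrightarrow> k = i)} = m"
    "card (tau ` {p. tau p \<noteq> p}) = L"
proof -
  obtain e :: "'n \<Rightarrow> nat" where e: "bij_betw e UNIV {0..<n}"
    using ex_bij_betw_finite_nat[of "UNIV :: 'n set"] n by auto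
  define d where "d = inv_into UNIV e"
  have de [simp]: "d (e i) = i" for i
    using e unfolding d_def bij_betw_def by simp
  have ed [simp]: "e (d j) = j" if "j < n" for j
    using e that unfolding d_def bij_betw_def by (simp add: f_inv_into_f)
  have en [simp]: "e i < n" for i
    using e unfolding bij_betw_def by auto
  have inj: "inj_on d {0..<n}"
    by (rule inj_on_inverseI[of _ e]) simp
  \<comment> \<open>The first \<open>3 * L\<close> numbers form blocks of three, a multiple of 3
    being the radius over the other two; the last \<open>m\<close> are lines. The numbers in between
    go to 0 and enlarge the base of the first cone.\<close>
  define t :: "nat \<Rightarrow> nat" where
    "t j = (if j < 3 * L then 3 * (j div 3) else if j < n - m then 0 else j)" for j
  have tn [simp]: "t j < n" if "j < n" for j
    using that by (auto simp: t_def intro: le_less_trans)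
  have tt [simp]: "t (t j) = t j" for j
    using L by (auto simp: t_def)
  have te: "t j = j \<longleftrightarrow> 3 dvd j \<and> j < 3 * L \<or> n - m \<le> j" for j
    using mL L unfolding t_def by (auto; presburger)
  have two: "\<exists>q<n. q \<noteq> p \<and> t q \<noteq> q \<and> t q = t p" if p: "p < n" "t p \<noteq> p" for p
  proof (cases "p < 3 * L")
    case True
    define a where "a = p div 3"
    have "p = 3 * a + 1 \<or> p = 3 * a + 2"
      using p True unfolding a_def t_def by (auto; presburger)
    moreover have "3 * a + 2 < 3 * L"
      using calculation True by presburger
    ultimately show ?thesis
    proof (elim disjE)
      assume "p = 3 * a + 1"
      then show ?thesis
        using \<open>3 * a + 2 < 3 * L\<close> mL by (intro exI[of _ "3 * a + 2"]) (simp add: t_def, presburger)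
    next
      assume "p = 3 * a + 2"
      then show ?thesis
        using \<open>3 * a + 2 < 3 * L\<close> mL by (intro exI[of _ "3 * a + 1"]) (simp add: t_def, presburger)
    qed
  next
    case False
    \<comment> \<open>A surplus coordinate lies over 0, and 1 always belongs to the same
      base.\<close>
    then have "t p = 0" using p by (auto simp: t_def)
    then show ?thesis using False L mL by (intro exI[of _ 1]) (auto simp: t_def)
  qed
  define tau where "tau i = d (t (e i))" for i
  have taud: "tau (d j) = d (t j)" if "j < n" for j
    using that by (simp add: tau_def)
  have tau_eq: "tau i = d j \<longleftrightarrow> t (e i) = j" if "j < n" for i j
    unfolding tau_def using that by (metis ed en tn)
  have fix_iff: "tau i = i \<longleftrightarrow> t (e i) = e i" for i
    using tau_eq[of "e i" i] by simp
  have "cone_product tau (d 1)"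
  proof
    show "tau (tau i) = tau i" for i by (simp add: tau_def)
    show "tau (d 1) \<noteq> d 1"
      using L mL fix_iff[of "d 1"] by (simp add: t_def)
    fix p assume "tau p \<noteq> p"
    then have "t (e p) \<noteq> e p" using fix_iff by blast
    then obtain q where q: "q < n" "q \<noteq> e p" "t q \<noteq> q" "t q = t (e p)"
      using two[OF en] by blast
    have "e (d q) \<noteq> e p" using q by simp
    then have "d q \<noteq> p" by blast
    moreover have "tau (d q) \<noteq> d q" using q fix_iff[of "d q"] by simp
    moreover have "tau (d q) = tau p" using taud[OF q(1)] q(4) by (simp only: tau_def)
    ultimately show "\<exists>q. q \<noteq> p \<and> tau q \<noteq> q \<and> tau q = tau p" by blast
  qed
  moreover have "{i. tau i = i \<and> (\<forall>k. tau k = i \<longrightarrow> k = i)} = d ` {n - m..<n}"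
  proof (intro set_eqI iffI)
    fix i assume i: "i \<in> {i. tau i = i \<and> (\<forall>k. tau k = i \<longrightarrow> k = i)}"
    have "n - m \<le> e i"
    proof (rule ccontr)
      assume lt: "\<not> n - m \<le> e i"
      then have d3: "3 dvd e i" "e i < 3 * L" using i fix_iff te by auto
      then have "e i + 1 < 3 * L" by presburger
      then have lt': "e i + 1 < n" using mL by linarith
      have "t (e i + 1) = e i"
        using d3 \<open>e i + 1 < 3 * L\<close> unfolding t_def by (auto; presburger)
      then have "tau (d (e i + 1)) = i" using lt' by (simp add: taud)
      then have "d (e i + 1) = i" using i by blast
      then have "e (d (e i + 1)) = e i" by simp
      then show False using lt' by simp
    qed
    then show "i \<in> d ` {n - m..<n}"
      by (intro image_eqI[of _ _ "e i"]) auto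
  next
    fix i assume "i \<in> d ` {n - m..<n}"
    then obtain j where j: "i = d j" "n - m \<le> j" "j < n" by auto
    have "k = i" if "tau k = i" for k
    proof -
      have "t (e k) = j" using that j tau_eq by simp
      then have "e k = j" using j(2) mL L unfolding t_def by (auto split: if_splits)
      then show ?thesis using j(1) by auto
    qed
    moreover have "tau i = i" using j te[of j] by (simp add: taud)
    ultimately show "i \<in> {i. tau i = i \<and> (\<forall>k. tau k = i \<longrightarrow> k = i)}" by blast
  qed
  then have "card {i. tau i = i \<and> (\<forall>k. tau k = i \<longrightarrow> k = i)} = m"
    using mL inj by (simp add: card_image inj_on_subset)
  moreover have "tau ` {p. tau p \<noteq> p} = d ` ((\<lambda>a. 3 * a) ` {0..<L})"
  proof (intro set_eqI iffI)
    fix i assume "i \<in> tau ` {p. tau p \<noteq> p}"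
    then obtain p where p: "i = d (t (e p))" "t (e p) \<noteq> e p"
      using fix_iff by (auto simp: tau_def)
    then have "t (e p) \<in> (\<lambda>a. 3 * a) ` {0..<L}"
      using L unfolding t_def by (auto split: if_splits)
    then show "i \<in> d ` ((\<lambda>a. 3 * a) ` {0..<L})" using p(1) by blast
  next
    fix i assume "i \<in> d ` ((\<lambda>a. 3 * a) ` {0..<L})"
    then obtain a where a: "i = d (3 * a)" "a < L" by auto
    then have an: "3 * a + 1 < n" using mL by linarith
    have "3 * a + 1 < 3 * L" "(3 * a + 1) div 3 = a" using a(2) by linarith+
    then have "t (3 * a + 1) = 3 * a" by (simp add: t_def)
    then have "tau (d (3 * a + 1)) = i" "tau (d (3 * a + 1)) \<noteq> d (3 * a + 1)"
      using a an fix_iff[of "d (3 * a + 1)"] by (simp_all add: taud)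
    then show "i \<in> tau ` {p. tau p \<noteq> p}" by blast
  qed
  moreover have "card (d ` ((\<lambda>a. 3 * a) ` {0..<L})) = L"
  proof -
    have "(\<lambda>a. 3 * a) ` {0..<L} \<subseteq> {0..<n}" using mL by auto
    then have "card (d ` ((\<lambda>a. 3 * a) ` {0..<L})) = card ((\<lambda>a. 3 * a :: nat) ` {0..<L})"
      using inj by (meson card_image inj_on_subset)
    then show ?thesis by (simp add: card_image inj_on_def)
  qed
  ultimately show ?thesis using that[of tau "d 1"] by simp
qed

theorem theorem2:
  fixes n k l :: nat
  assumes "CARD('n::finite) = n"
    and "n \<ge> 3"
    and "k \<le> n - 2"
    and "1 \<le> l"
    and "l \<le> (n - k + 1) div 3"
    and "k * (k + 1) div 2 + l \<ge> 2"
  shows "\<exists>g :: real ^ 'n \<Rightarrow> real ^ 'n ^ 'n.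
    lorentzian g \<and>
    (\<exists>h. pseudo_riemannian h \<and> geodesically_equivalent g h \<and> \<not> affinely_equivalent g h) \<and>
    degree_of_mobility g = k * (k + 1) div 2 + l"
proof -
  \<comment> \<open>The pair \<open>(0, l)\<close> gives the same dimension as \<open>(1, l - 1)\<close>.\<close>
  define m where "m = k - 1"
  define L where "L = (if k = 0 then l - 1 else l)"
  have L: "L \<ge> 1" using assms(4,6) by (auto simp: L_def)
  \<comment> \<open>For k \<ge> 1 this says (k - 1) + 3 l \<le> n. For k = 0 the truncated
    \<open>k - 1\<close> is 0, and 3 (l - 1) \<le> n - 2.\<close>
  have "3 * l \<le> n - k + 1" using assms(5) by presburger
  then have mL: "m + 3 * L \<le> n"
    using assms(2,3,4) unfolding m_def L_def by (auto split: if_splits)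
  have deg: "(m + 1) * (m + 2) div 2 + L = k * (k + 1) div 2 + l"
    using assms(4) by (cases k) (simp_all add: m_def L_def)
  obtain tau :: "'n \<Rightarrow> 'n" and neg where cone: "cone_product tau neg"
    and card: "card {i. tau i = i \<and> (\<forall>k. tau k = i \<longrightarrow> k = i)} = m" "card (tau ` {p. tau p \<noteq> p}) = L"
    using cone_product_exists[OF assms(1) L mL] .
  interpret cone_product tau neg by (rule cone)
  have "flats = {i. tau i = i \<and> (\<forall>k. tau k = i \<longrightarrow> k = i)}"
    using flats_iff by blast
  then have "degree_of_mobility g = k * (k + 1) div 2 + l"
    unfolding deg[symmetric] degree_of_mobility_g tops_def card(2) using card(1) by simp
  then show ?thesis
    using lorentzian_g pseudo_riemannian_h geodesically_equivalent not_affinely_equivalent by blast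
qed

end
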